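(* Let $A\in\mathbb R^{2n\times 2n}$ be symmetric positive definite, with blocks $A_{11},A_{12},A_{22}\in\mathbb R^{n\times n}$, and assume that Algorithm $W_1$ applied to $A$ in floating-point arithmetic with machine precision $u$ runs to completion, producing the block lower triangular matrix $\tilde L_1=\begin{pmatrix}\tilde L_{11}&0\\ \tilde L_{21}&\tilde L_{22}\end{pmatrix}$. Let $\tilde A_{11}=\tilde L_{11}\tilde L_{11}^T$, $\tilde A_{12}=\tilde L_{11}\tilde L_{21}^T$, and assume that the matrix $$\tilde A=\begin{pmatrix}\tilde A_{11}&\tilde A_{12}\\ \tilde A_{12}^T&A_{22}\end{pmatrix}$$ is positive definite. Let $S=A_{22}-A_{12}^TA_{11}^{-1}A_{12}$ and $\tilde S=A_{22}-\tilde A_{12}^T\tilde A_{11}^{-1}\tilde A_{12}$. Then $$\|\tilde A_{11}^{-1}-A_{11}^{-1}\|_2\le n\gamma_{n+1}(u)\,\kappa_2(A_{11})\,\|A_{11}^{-1}\|_2+\mathcal O(u^2),$$ $$\|\tilde S-S\|_2\le 3n\gamma_{n+1}(u)\,\kappa_2(A_{11})\,\|A\|_2+\mathcal O(u^2),$$ $$\|\tilde A_{11}^{-1}-\tilde S\|_2\le\|A_{11}^{-1}-S\|_2+n\gamma_{n+1}(u)\,\kappa_2(A_{11})\left(\|A_{11}^{-1}\|_2+3\|A\|_2\right)+\mathcal O(u^2).$$ Moreover, the factorization error in Algorithm $W_1$ satisfies $$\|A-\tilde L_1\tilde L_1^T\|_2\le\|A_{11}^{-1}-S\|_2+2n\gamma_{n+1}(u)\|A\|_2+3n\gamma_{n+1}(u)\,\kappa_2(A_{11})\left(\|A\|_2+\|A_{11}^{-1}\|_2\right)+\mathcal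 O(u^2).$$
   Context: $\|\cdot\|_2$ is the spectral norm, $\kappa_2(M)=\|M^{-1}\|_2\|M\|_2$, and $\gamma_k(u)=\frac{ku}{1-ku}$ for $ku<1$. $\mathcal O(u^2)$ refers to $u\to0$ with $A$ (and $n$) fixed. Floating-point computations follow the standard model: each operation $\mathrm{op}\in\{+,-,\times,/\}$ satisfies $\mathrm{fl}(x\ \mathrm{op}\ y)=(x\ \mathrm{op}\ y)(1+\delta)$ with $|\delta|\le u$, similarly for square roots, and no overflow or underflow occurs. Write $A=\begin{pmatrix}A_{11}&A_{12}\\ A_{12}^T&A_{22}\end{pmatrix}$ with $n\times n$ blocks. Algorithm $W_1$ (applied to a symmetric positive definite $A$, not necessarily symplectic): 1. compute the Cholesky factorization $A_{11}=L_{11}L_{11}^T$ ($L_{11}$ lower triangular with positive diagonal); 2. solve $L_{11}L_{21}^T=A_{12}$ for $L_{21}$ by forward substitution; 3. solve $L_{11}X=I$ for $X$ by forward substitution; 4. set $U_{22}=X^T$; 5. set $L_{22}=U_{22}$. The output is $L_1=\begin{pmatrix}L_{11}&0\\ L_{21}&L_{22}\end{pmatrix}$. Tildes on $L_{11},L_{21},L_{22},L_1$ denote the quantities actually computed in floating-point arithmetic. *)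

theory Defs
  imports "HOL-Analysis.Analysis" "HOL-Library.Multiset" "HOL-Library.Landau_Symbols"
begin

definition pos_def :: "real^'n^'n \<Rightarrow> bool" where
  "pos_def M \<longleftrightarrow> (\<forall>x. x \<noteq> 0 \<longrightarrow> 0 < x \<bullet> (M *v x))"

text \<open>The norm on \<open>real^'n\<close> is the Euclidean one, so its operator norm is the spectral norm.\<close>

definition spectral_norm :: "real^'n^'m \<Rightarrow> real" where
  "spectral_norm M = onorm (\<lambda>x. M *v x)"

definition cond_number :: "real^'n^'n \<Rightarrow> real" where
  "cond_number M = spectral_norm (matrix_inv M) * spectral_norm M"

definition gamma_err :: "nat \<Rightarrow> real \<Rightarrow> real" where
  "gamma_err k u = real k * u / (1 - real k * u)"

text \<open>Matrices of order \<open>2n\<close> are indexed by \<open>'n + 'n\<close>.\<close>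

definition block_mat ::
  "real^'n^'n \<Rightarrow> real^'n^'n \<Rightarrow> real^'n^'n \<Rightarrow> real^'n^'n \<Rightarrow> real^('n + 'n)^('n + 'n)" where
  "block_mat P Q R T = (\<chi> i j. case i of
      Inl a \<Rightarrow> (case j of Inl b \<Rightarrow> P $ a $ b | Inr b \<Rightarrow> Q $ a $ b)
    | Inr a \<Rightarrow> (case j of Inl b \<Rightarrow> R $ a $ b | Inr b \<Rightarrow> T $ a $ b))"

text \<open>Schur complement of \<open>P\<close> in the symmetric block matrix with blocks \<open>P\<close>, \<open>Q\<close>, \<open>Q\<^sup>T\<close>, \<open>T\<close>.\<close>

definition schur_complement :: "real^'n^'n \<Rightarrow> real^'n^'n \<Rightarrow> real^'n^'n \<Rightarrow> real^'n^'n" where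
  "schur_complement P Q T = T - transpose Q ** matrix_inv P ** Q"

text \<open>
  Floating-point arithmetic is described by the standard model with unit roundoff \<open>u\<close>:
  \<open>fl u x\<close> is the set of admissible computed values of an operation whose exact result is \<open>x\<close>.
  The algorithms below are relations between the data and the possible computed results,
  so that a statement about all related results covers every arithmetic obeying the model.
\<close>

definition fl :: "real \<Rightarrow> real \<Rightarrow> real set" where
  "fl u x = {x * (1 + \<delta>) | \<delta>. \<bar>\<delta>\<bar> \<le> u}"

text \<open>
  \<open>fl_sum u M s\<close>: the summands in \<open>M\<close>, added in floating-point arithmetic in some order and
  with some bracketing, may give \<open>s\<close>. Subtraction is addition of the negated
  operand, as changing a sign is exact.
\<close>

inductive fl_sum :: "real \<Rightarrow> real multiset \<Rightarrow> real \<Rightarrow> bool" for u where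
  single: "fl_sum u {#x#} x"
| add: "fl_sum u M s \<Longrightarrow> fl_sum u N t \<Longrightarrow> z \<in> fl u (s + t) \<Longrightarrow> fl_sum u (M + N) z"

text \<open>\<open>s\<close> is a computed value of \<open>c - (\<Sum>k\<in>K. a k * b k)\<close>, the order of evaluation being arbitrary.\<close>

definition fl_diff_inner ::
  "real \<Rightarrow> real \<Rightarrow> 'k set \<Rightarrow> ('k \<Rightarrow> real) \<Rightarrow> ('k \<Rightarrow> real) \<Rightarrow> real \<Rightarrow> bool" where
  "fl_diff_inner u c K a b s \<longleftrightarrow>
     (\<exists>p. (\<forall>k\<in>K. p k \<in> fl u (a k * b k)) \<and>
          fl_sum u (add_mset c (image_mset (\<lambda>k. - p k) (mset_set K))) s)"

text \<open>
  Cholesky factorization \<open>M = L L\<^sup>T\<close>. It runs to completion iff every computed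
  number \<open>s\<close> whose square root is taken is positive. For \<open>u < 1\<close> the diagonal of \<open>L\<close> is then positive.
\<close>

definition fl_cholesky :: "real \<Rightarrow> real^('n::{finite,linorder})^('n::{finite,linorder}) \<Rightarrow> real^('n::{finite,linorder})^('n::{finite,linorder}) \<Rightarrow> bool" where
  "fl_cholesky u M L \<longleftrightarrow>
     (\<forall>i j. i < j \<longrightarrow> L $ i $ j = 0) \<and>
     (\<forall>j. \<exists>s. fl_diff_inner u (M $ j $ j) {..<j} (\<lambda>k. L $ j $ k) (\<lambda>k. L $ j $ k) s \<and>
              0 < s \<and> L $ j $ j \<in> fl u (sqrt s)) \<and>
     (\<forall>i j. j < i \<longrightarrow>
        (\<exists>s. fl_diff_inner u (M $ i $ j) {..<j} (\<lambda>k. L $ i $ k) (\<lambda>k. L $ j $ k) s \<and>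
             L $ j $ j \<noteq> 0 \<and> L $ i $ j \<in> fl u (s / L $ j $ j)))"

text \<open>Solution of \<open>L X = B\<close>, column by column, for lower triangular \<open>L\<close>.\<close>

definition fl_forward_subst ::
  "real \<Rightarrow> real^('n::{finite,linorder})^('n::{finite,linorder}) \<Rightarrow> real^'m^('n::{finite,linorder}) \<Rightarrow> real^'m^('n::{finite,linorder}) \<Rightarrow> bool" where
  "fl_forward_subst u L B X \<longleftrightarrow>
     (\<forall>i j. \<exists>s. fl_diff_inner u (B $ i $ j) {..<i} (\<lambda>k. L $ i $ k) (\<lambda>k. X $ k $ j) s \<and>
                L $ i $ i \<noteq> 0 \<and> X $ i $ j \<in> fl u (s / L $ i $ i))"

text \<open>
  Algorithm \<open>W\<^sub>1\<close> runs to completion in floating-point arithmetic and may return the blocks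
  \<open>L11\<close>, \<open>L21\<close>, \<open>L22\<close>. It does not read the block \<open>A22\<close>.
\<close>

definition fl_W1 ::
  "real \<Rightarrow> real^('n::{finite,linorder})^('n::{finite,linorder}) \<Rightarrow> real^('n::{finite,linorder})^('n::{finite,linorder}) \<Rightarrow>
   real^('n::{finite,linorder})^('n::{finite,linorder}) \<Rightarrow>
   real^('n::{finite,linorder})^('n::{finite,linorder}) \<Rightarrow>
   real^('n::{finite,linorder})^('n::{finite,linorder}) \<Rightarrow> bool" where
  "fl_W1 u A11 A12 L11 L21 L22 \<longleftrightarrow>
     fl_cholesky u A11 L11 \<and>
     fl_forward_subst u L11 A12 (transpose L21) \<and>
     (\<exists>X U22. fl_forward_subst u L11 (mat 1) X \<and> U22 = transpose X \<and> L22 = U22)"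

end

theory Submission
  imports Defs
begin

text \<open>
Two ideas carry the theorem: componentwise backward error bounds for the three triangular
computations, and exact perturbation identities in which these errors enter explicitly.

\<^bold>\<open>Backward errors.\<close> Let \<open>n\<close> be the order of the blocks, \<open>L\<close>, \<open>K\<close>, \<open>N\<close> the computed blocks
\<open>L11\<close>, \<open>L21\<close>, \<open>L22\<close>, and \<open>g = \<gamma>\<^bsub>n+1\<^esub>(u)\<close>. Whatever the order of evaluation, each residual entry is at most
\<open>g\<close> times the inner product of the absolute values that it comes from
(\<open>fl_cholesky_residual\<close>, \<open>fl_forward_subst_residual\<close>). The Cauchy--Schwarz inequality turns
this into the Frobenius norm bounds
\<open>g * norm L * norm L\<close>, \<open>g * norm L * norm K\<close>, \<open>g * norm L * norm N\<close>
for the three residuals \<open>A11 - L L\<^sup>T\<close>, \<open>A12 - L K\<^sup>T\<close>, \<open>I - L N\<^sup>T\<close> (\<open>fl_W1_residuals\<close>).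

\<^bold>\<open>The factor n.\<close> The squared Frobenius norm of a factor is the trace of its Gram matrix,
hence at most \<open>n\<close> times a spectral norm. The Gram matrix of \<open>L\<close> is the perturbed block \<open>P = L L\<^sup>T\<close>;
that of \<open>K\<close> is bounded by \<open>A22\<close> because the perturbed matrix is positive definite
(\<open>norm_offdiagonal_factor_le\<close>); that of \<open>N\<close> is nearly the inverse of \<open>P\<close>
(\<open>approximate_inverse_gram\<close>). So with \<open>x = n g\<close>, \<open>a\<close>, \<open>c\<close> the norms of \<open>A11\<close>, \<open>A22\<close> and \<open>b\<close>
that of the inverse of \<open>A11\<close>, the residuals are to first order at most
\<open>x a\<close>, \<open>x \<surd>(a c)\<close> and \<open>x \<surd>(a b)\<close>.

\<^bold>\<open>Perturbation.\<close> Write \<open>E\<close>, \<open>F\<close> for the residuals \<open>A11 - P\<close>, \<open>A12 - Q\<close>, with \<open>Q = L K\<^sup>T\<close>.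
The inverses of \<open>A11\<close> and \<open>P\<close> differ by \<open>A11\<^sup>-\<^sup>1 E P\<^sup>-\<^sup>1\<close>. With
\<open>Y = A11\<^sup>-\<^sup>1 A12\<close> and \<open>Y' = P\<^sup>-\<^sup>1 Q\<close> the Schur complements differ exactly by
\<open>F\<^sup>T Y' + Y\<^sup>T F - Y\<^sup>T E Y'\<close> (\<open>schur_complement_diff\<close>), and positive definiteness
bounds \<open>Y\<close> by \<open>\<surd>(b c)\<close> rather than by the product of the norms of its factors
(\<open>spectral_norm_inv_times_block\<close>). That is what keeps the condition number \<open>\<kappa> = a b\<close> linear in
the bound: the three terms are of size
\<open>x c \<surd>\<kappa>\<close>, \<open>x c \<surd>\<kappa>\<close> and \<open>x c \<kappa>\<close>, and \<open>\<kappa> \<ge> 1\<close>.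

\<^bold>\<open>Factorization error.\<close> \<open>A - L\<^sub>1 L\<^sub>1\<^sup>T\<close> has the blocks \<open>E\<close>, \<open>F\<close>, \<open>F\<^sup>T\<close> and \<open>S' - N N\<^sup>T\<close>, where \<open>S'\<close>
is the perturbed Schur complement, since \<open>S' = A22 - K K\<^sup>T\<close>. The last block is
\<open>S' - P\<^sup>-\<^sup>1\<close> up to \<open>2 x \<kappa> b\<close>.

All inequalities are first proved with explicit remainders, multiples of \<open>y\<^sup>2\<close> with
\<open>y = x \<kappa> \<le> 1 / 16\<close> (\<open>W1_perturbation_bounds\<close>). These depend on \<open>A\<close> and \<open>u\<close> only and are
therefore the required uniform \<open>O(u\<^sup>2)\<close> terms.
\<close>

section \<open>Rounding errors of inner products\<close>

text \<open>
The accumulated effect of \<open>k\<close> roundings, each multiplying or dividing by some \<open>1 + \<delta>\<close> with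
\<open>\<bar>\<delta>\<bar> \<le> u\<close>. The interval is symmetric under inversion, so that divisions need no separate treatment.
\<close>

definition rounding_factor :: "real \<Rightarrow> nat \<Rightarrow> real \<Rightarrow> bool" where
  "rounding_factor u k t \<longleftrightarrow> (1 - u) ^ k \<le> t \<and> t \<le> 1 / (1 - u) ^ k"

text \<open>
The largest distance of a rounding factor from \<open>1\<close>. Unlike \<open>gamma_err\<close> it satisfies an exact
composition law, \<open>(1 + excess u k) * (1 + excess u l) = 1 + excess u (k + l)\<close>, and is
replaced by \<open>gamma_err\<close> only once all roundings of an entry have been collected.
\<close>

definition excess :: "real \<Rightarrow> nat \<Rightarrow> real" where
  "excess u k = 1 / (1 - u) ^ k - 1"

context
  fixes u :: real
  assumes u0: "0 \<le> u" and u1: "u < 1"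
begin

lemma rounding_factor_pos: "rounding_factor u k t \<Longrightarrow> 0 < t"
  unfolding rounding_factor_def using u1 by (smt (verit) zero_less_power)

lemma rounding_factor_mult:
  assumes "rounding_factor u k t" "rounding_factor u l s"
  shows "rounding_factor u (k + l) (t * s)"
proof -
  have p: "0 < (1 - u) ^ k" "0 < (1 - u) ^ l" using u1 by auto
  have "(1 - u) ^ k * (1 - u) ^ l \<le> t * s"
    using assms p unfolding rounding_factor_def by (intro mult_mono) auto
  moreover have "t * s \<le> (1 / (1 - u) ^ k) * (1 / (1 - u) ^ l)"
    using assms p unfolding rounding_factor_def by (intro mult_mono) auto
  ultimately show ?thesis
    unfolding rounding_factor_def by (simp add: power_add)
qed

lemma rounding_factor_inverse:
  assumes "rounding_factor u k t"
  shows "rounding_factor u k (1 / t)"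
proof -
  have p: "0 < (1 - u) ^ k" using u1 by auto
  have "0 < t" using assms by (rule rounding_factor_pos)
  then show ?thesis
    using assms p unfolding rounding_factor_def by (auto simp: field_simps)
qed

lemma rounding_factor_one_plus:
  assumes "\<bar>\<delta>\<bar> \<le> u"
  shows "rounding_factor u 1 (1 + \<delta>)"
proof -
  have "(1 + \<delta>) * (1 - u) \<le> (1 + u) * (1 - u)"
    using assms u1 by (intro mult_right_mono) auto
  also have "\<dots> \<le> 1" by (simp add: algebra_simps)
  finally show ?thesis
    using assms u1 unfolding rounding_factor_def by (auto simp: field_simps)
qed

lemma excess_mono: "k \<le> l \<Longrightarrow> excess u k \<le> excess u l"
  unfolding excess_def using u0 u1
  by (auto intro!: divide_left_mono power_decreasing)

lemma excess_nonneg: "0 \<le> excess u k"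
  using excess_mono[of 0 k] by (simp add: excess_def)

lemma rounding_factor_mono:
  assumes "rounding_factor u k t" "k \<le> l"
  shows "rounding_factor u l t"
proof -
  have "(1 - u) ^ l \<le> (1 - u) ^ k" using u0 u1 assms(2) by (auto intro!: power_decreasing)
  then show ?thesis
    using assms(1) excess_mono[OF assms(2)] unfolding rounding_factor_def excess_def by auto
qed

lemma rounding_factor_excess:
  assumes "rounding_factor u k t"
  shows "\<bar>t - 1\<bar> \<le> excess u k" "t \<le> 1 + excess u k"
proof -
  define v where "v = (1 - u) ^ k"
  have v: "0 < v" using u1 by (auto simp: v_def)
  have "0 \<le> (1 - v)\<^sup>2 / v" using v by simp
  also have "(1 - v)\<^sup>2 / v = 1 / v - 1 - (1 - v)"
    using v by (simp add: field_simps power2_eq_square)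
  finally have "1 - v \<le> 1 / v - 1" by simp
  then show "\<bar>t - 1\<bar> \<le> excess u k" "t \<le> 1 + excess u k"
    using assms unfolding rounding_factor_def excess_def v_def by auto
qed

lemma excess_le_gamma_err:
  assumes "real k * u < 1"
  shows "excess u k \<le> gamma_err k u"
proof -
  have "1 + real k * (- u) \<le> (1 + (- u)) ^ k"
    using u1 by (intro Bernoulli_inequality) auto
  then have "1 / (1 - u) ^ k \<le> 1 / (1 - real k * u)"
    using assms u1 by (intro divide_left_mono) auto
  also have "\<dots> = 1 + gamma_err k u"
    using assms by (simp add: gamma_err_def field_simps)
  finally show ?thesis by (simp add: excess_def)
qed

text \<open>
The composition law in the form used below: an error of \<open>k\<close> roundings relative to \<open>X\<close>,
followed by \<open>l\<close> further roundings, is an error of \<open>k + l\<close> roundings relative to \<open>X\<close>.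
\<close>

lemma excess_perturb:
  assumes "\<bar>s - x\<bar> \<le> excess u k * X" "\<bar>x\<bar> \<le> X" "rounding_factor u l t"
  shows "\<bar>s * t - x\<bar> \<le> excess u (k + l) * X"
proof -
  have t: "0 < t" by (rule rounding_factor_pos) fact
  have X: "0 \<le> X" using assms(2) by linarith
  have "s * t - x = (s - x) * t + x * (t - 1)" by (simp add: algebra_simps)
  then have "\<bar>s * t - x\<bar> \<le> \<bar>s - x\<bar> * \<bar>t\<bar> + \<bar>x\<bar> * \<bar>t - 1\<bar>"
    by (metis abs_mult abs_triangle_ineq)
  also have "\<dots> \<le> (excess u k * X) * (1 + excess u l) + X * excess u l"
    using assms t X rounding_factor_excess[OF assms(3)] excess_nonneg[of k]
    by (intro add_mono mult_mono) auto
  also have "\<dots> = excess u (k + l) * X"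
  proof -
    have "(p - 1) * X * q + X * (q - 1) = (p * q - 1) * X" for p q :: real
      by (simp add: algebra_simps)
    then show ?thesis
      by (simp add: excess_def power_add flip: divide_divide_eq_left) (simp add: divide_inverse)
  qed
  finally show ?thesis .
qed

lemma fl_sum_nonempty: "fl_sum u M s \<Longrightarrow> M \<noteq> {#}"
  by (induction rule: fl_sum.induct) auto

lemma sum_mset_abs_ge: "\<bar>\<Sum>\<^sub># M\<bar> \<le> (\<Sum>x\<in>#M. \<bar>x :: real\<bar>)"
  by (induction M) auto

lemma sum_mset_abs_nonneg: "0 \<le> (\<Sum>x\<in>#M. \<bar>x :: real\<bar>)"
  using sum_mset_abs_ge[of M] by linarith

text \<open>
A summation tree with \<open>m\<close> leaves has \<open>m - 1\<close> internal nodes, so no leaf passes through more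
than \<open>m - 1\<close> additions, whatever the bracketing.
\<close>

lemma fl_sum_error:
  assumes "fl_sum u M s"
  shows "\<bar>s - \<Sum>\<^sub># M\<bar> \<le> excess u (size M - 1) * (\<Sum>x\<in>#M. \<bar>x\<bar>)"
  using assms
proof (induction rule: fl_sum.induct)
  case (single x)
  then show ?case by (simp add: excess_def)
next
  case (add M s N t z)
  obtain \<delta> where \<delta>: "\<bar>\<delta>\<bar> \<le> u" "z = (s + t) * (1 + \<delta>)"
    using add.hyps by (auto simp: fl_def)
  have ne: "size M \<ge> 1" "size N \<ge> 1"
    using add.hyps(1,2)[THEN fl_sum_nonempty]
    by (simp_all add: Suc_le_eq nonempty_has_size[symmetric])
  have 1: "\<bar>s * (1 + \<delta>) - \<Sum>\<^sub># M\<bar> \<le> excess u (size M - 1 + 1) * (\<Sum>x\<in>#M. \<bar>x\<bar>)"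
    by (rule excess_perturb[OF add.IH(1) sum_mset_abs_ge rounding_factor_one_plus]) fact
  have 2: "\<bar>t * (1 + \<delta>) - \<Sum>\<^sub># N\<bar> \<le> excess u (size N - 1 + 1) * (\<Sum>x\<in>#N. \<bar>x\<bar>)"
    by (rule excess_perturb[OF add.IH(2) sum_mset_abs_ge rounding_factor_one_plus]) fact
  have nn: "0 \<le> (\<Sum>x\<in>#M. \<bar>x\<bar>)" "0 \<le> (\<Sum>x\<in>#N. \<bar>x\<bar>)" by (rule sum_mset_abs_nonneg)+
  have "z - \<Sum>\<^sub># (M + N) = (s * (1 + \<delta>) - \<Sum>\<^sub># M) + (t * (1 + \<delta>) - \<Sum>\<^sub># N)"
    by (simp add: \<delta> algebra_simps)
  then have "\<bar>z - \<Sum>\<^sub># (M + N)\<bar>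
      \<le> excess u (size M - 1 + 1) * (\<Sum>x\<in>#M. \<bar>x\<bar>) + excess u (size N - 1 + 1) * (\<Sum>x\<in>#N. \<bar>x\<bar>)"
    using 1 2 by linarith
  also have "\<dots> \<le> excess u (size (M + N) - 1) * (\<Sum>x\<in>#M. \<bar>x\<bar>)
      + excess u (size (M + N) - 1) * (\<Sum>x\<in>#N. \<bar>x\<bar>)"
    using ne nn by (intro add_mono mult_right_mono excess_mono) auto
  finally show ?case by (simp add: algebra_simps)
qed

text \<open>
For a backward error result one summand \<open>c\<close> must stay exact. The rounding factors on the path
from \<open>c\<close> to the root are moved to the computed sum, where they form \<open>t\<close>. Another summand shares
with \<open>c\<close> the node at which their paths meet and all nodes above it, whose factors cancel; hence
in a tree with \<open>m\<close> leaves only \<open>m - 2\<close> of the \<open>m - 1\<close> internal nodes can affect it. This is the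
induction step, with \<open>c\<close> in the left subtree \<open>M\<close>.
\<close>

lemma fl_sum_pivot_step:
  assumes M: "rounding_factor u (size M - 1) t1"
             "\<bar>s1 * t1 - \<Sum>\<^sub># M\<bar> \<le> excess u (size M - 2) * (\<Sum>x\<in>#M - {#c#}. \<bar>x\<bar>)"
    and c: "c \<in># M" and N: "fl_sum u N s2" and z: "z \<in> fl u (s1 + s2)"
  shows "\<exists>t. rounding_factor u (size (M + N) - 1) t \<and>
             \<bar>z * t - \<Sum>\<^sub># (M + N)\<bar> \<le> excess u (size (M + N) - 2) * (\<Sum>x\<in>#(M + N) - {#c#}. \<bar>x\<bar>)"
proof -
  obtain \<delta> where \<delta>: "\<bar>\<delta>\<bar> \<le> u" "z = (s1 + s2) * (1 + \<delta>)"
    using z by (auto simp: fl_def)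
  have ne: "size M \<ge> 1" "size N \<ge> 1"
    using c fl_sum_nonempty[OF N]
    by (auto simp add: Suc_le_eq nonempty_has_size[symmetric])
  have d: "rounding_factor u 1 (1 + \<delta>)" using \<delta>(1) by (rule rounding_factor_one_plus)
  define t where "t = t1 * (1 / (1 + \<delta>))"
  have "(1 + \<delta>) * (1 / (1 + \<delta>)) = 1" using rounding_factor_pos[OF d] by simp
  then have zt: "z * t = s1 * t1 + s2 * t1"
    unfolding t_def \<delta>(2) by algebra
  have "rounding_factor u (size M - 1 + 1) t"
    unfolding t_def by (intro rounding_factor_mult rounding_factor_inverse M d)
  then have 1: "rounding_factor u (size (M + N) - 1) t"
    by (rule rounding_factor_mono) (use ne in auto)
  have 2: "\<bar>s2 * t1 - \<Sum>\<^sub># N\<bar> \<le> excess u (size N - 1 + (size M - 1)) * (\<Sum>x\<in>#N. \<bar>x\<bar>)"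
    by (rule excess_perturb[OF fl_sum_error[OF N] sum_mset_abs_ge M(1)])
  have nn: "0 \<le> (\<Sum>x\<in>#M - {#c#}. \<bar>x\<bar>)" by (rule sum_mset_abs_nonneg)+
  have "\<bar>z * t - \<Sum>\<^sub># (M + N)\<bar> \<le> excess u (size M - 2) * (\<Sum>x\<in>#M - {#c#}. \<bar>x\<bar>)
      + excess u (size N - 1 + (size M - 1)) * (\<Sum>x\<in>#N. \<bar>x\<bar>)"
    using 2 M(2) unfolding zt by simp
  also have "\<dots> \<le> excess u (size (M + N) - 2) * (\<Sum>x\<in>#M - {#c#}. \<bar>x\<bar>)
      + excess u (size (M + N) - 2) * (\<Sum>x\<in>#N. \<bar>x\<bar>)"
    using ne nn by (intro add_mono mult_right_mono excess_mono sum_mset_abs_nonneg) auto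
  also have "\<dots> = excess u (size (M + N) - 2) * (\<Sum>x\<in>#(M + N) - {#c#}. \<bar>x\<bar>)"
    using c by (auto simp: algebra_simps dest!: multi_member_split)
  finally show ?thesis using 1 by blast
qed

text \<open>
For a single leaf the truncated difference \<open>size M - 2\<close> is \<open>0\<close>, and the error bound vanishes as it
should.
\<close>

lemma fl_sum_pivot_error:
  assumes "fl_sum u M s" "c \<in># M"
  shows "\<exists>t. rounding_factor u (size M - 1) t \<and>
             \<bar>s * t - \<Sum>\<^sub># M\<bar> \<le> excess u (size M - 2) * (\<Sum>x\<in>#M - {#c#}. \<bar>x\<bar>)"
  using assms
proof (induction rule: fl_sum.induct)
  case (single x)
  then show ?case by (intro exI[of _ 1]) (auto simp: rounding_factor_def)
next
  case (add M s N t z)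
  consider "c \<in># M" | "c \<in># N" using add.prems by auto
  then show ?case
  proof cases
    case 1
    then show ?thesis using fl_sum_pivot_step add by meson
  next
    case 2
    have "z \<in> fl u (t + s)" using add.hyps(3) by (simp add: add.commute)
    then show ?thesis using fl_sum_pivot_step[OF _ _ 2 add.hyps(1)] add.IH(2)[OF 2]
      by (metis add.commute)
  qed
qed

lemma sum_mset_negf: "(\<Sum>x\<in>#M. - f x) = - (\<Sum>x\<in>#M. f x :: real)"
  by (induction M) auto

text \<open>
The rounding of each product uses up the addition that the pivoted summation saves, so both
error counts equal the number of products.
\<close>

lemma fl_diff_inner_error:
  assumes K: "finite K" and s: "fl_diff_inner u c K a b s"
  shows "\<exists>t. rounding_factor u (card K) t \<and>
             \<bar>s * t - (c - (\<Sum>k\<in>K. a k * b k))\<bar> \<le> excess u (card K) * (\<Sum>k\<in>K. \<bar>a k\<bar> * \<bar>b k\<bar>)"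
proof (cases "K = {}")
  case True
  then have "fl_sum u {#c#} s" using s by (auto simp: fl_diff_inner_def)
  from fl_sum_pivot_error[OF this, of c] show ?thesis by (auto simp: True excess_def)
next
  case False
  obtain p where p: "\<And>k. k \<in> K \<Longrightarrow> p k \<in> fl u (a k * b k)"
    and fs: "fl_sum u (add_mset c (image_mset (\<lambda>k. - p k) (mset_set K))) s"
    using s unfolding fl_diff_inner_def by blast
  obtain t where t: "rounding_factor u (card K) t"
    and e: "\<bar>s * t - (c - (\<Sum>k\<in>K. p k))\<bar> \<le> excess u (card K - 1) * (\<Sum>k\<in>K. \<bar>p k\<bar>)"
    using fl_sum_pivot_error[OF fs, of c]
    by (auto simp: sum_unfold_sum_mset image_mset.compositionality o_def sum_mset_negf)
  have ab: "0 \<le> (\<Sum>k\<in>K. \<bar>a k\<bar> * \<bar>b k\<bar>)" by (auto intro!: sum_nonneg)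
  have pk: "\<bar>p k - a k * b k\<bar> \<le> u * (\<bar>a k\<bar> * \<bar>b k\<bar>)" "\<bar>p k\<bar> \<le> (1 + u) * (\<bar>a k\<bar> * \<bar>b k\<bar>)"
    if k: "k \<in> K" for k
  proof -
    obtain \<delta> where \<delta>: "\<bar>\<delta>\<bar> \<le> u" "p k = a k * b k * (1 + \<delta>)"
      using p[OF k] by (auto simp: fl_def)
    then have "p k - a k * b k = \<delta> * (a k * b k)" by (simp add: algebra_simps)
    then show 1: "\<bar>p k - a k * b k\<bar> \<le> u * (\<bar>a k\<bar> * \<bar>b k\<bar>)"
      using \<delta>(1) by (auto simp: abs_mult intro!: mult_right_mono)
    have "\<bar>a k * b k\<bar> = \<bar>a k\<bar> * \<bar>b k\<bar>" by (rule abs_mult)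
    with 1 show "\<bar>p k\<bar> \<le> (1 + u) * (\<bar>a k\<bar> * \<bar>b k\<bar>)"
      unfolding distrib_right by linarith
  qed
  have d: "\<bar>(\<Sum>k\<in>K. p k) - (\<Sum>k\<in>K. a k * b k)\<bar> \<le> u * (\<Sum>k\<in>K. \<bar>a k\<bar> * \<bar>b k\<bar>)"
    unfolding sum_subtractf[symmetric] sum_distrib_left
    by (rule order_trans[OF sum_abs]) (intro sum_mono pk)
  have P: "(\<Sum>k\<in>K. \<bar>p k\<bar>) \<le> (1 + u) * (\<Sum>k\<in>K. \<bar>a k\<bar> * \<bar>b k\<bar>)"
    unfolding sum_distrib_left by (intro sum_mono pk)
  have u_le: "u \<le> excess u 1" using u0 u1 by (simp add: excess_def field_simps)
  obtain m where m: "card K = Suc m" using False K by (metis card_0_eq not0_implies_Suc)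
  have "\<bar>s * t - (c - (\<Sum>k\<in>K. a k * b k))\<bar>
      \<le> excess u m * ((1 + u) * (\<Sum>k\<in>K. \<bar>a k\<bar> * \<bar>b k\<bar>)) + u * (\<Sum>k\<in>K. \<bar>a k\<bar> * \<bar>b k\<bar>)"
    using e d mult_left_mono[OF P excess_nonneg[of m]] by (simp add: m)
  also have "\<dots> = (excess u m * (1 + u) + u) * (\<Sum>k\<in>K. \<bar>a k\<bar> * \<bar>b k\<bar>)"
    by (simp add: algebra_simps)
  also have "\<dots> \<le> (excess u m * (1 + excess u 1) + excess u 1) * (\<Sum>k\<in>K. \<bar>a k\<bar> * \<bar>b k\<bar>)"
    using u_le excess_nonneg[of m] ab by (intro mult_right_mono add_mono mult_left_mono) auto
  also have "excess u m * (1 + excess u 1) + excess u 1 = excess u (Suc m)"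
    by (simp add: excess_def diff_divide_distrib flip: divide_divide_eq_left) (simp add: divide_inverse algebra_simps)
  finally show ?thesis using t m by auto
qed

text \<open>
Backward error of the equation \<open>(\<Sum>k\<in>K. a k * b k) + y = c\<close> when \<open>y\<close> results from the computed
difference \<open>s\<close> by \<open>j\<close> more roundings \<open>w\<close>: one division, or a square root that is squared
again. All errors are charged to the terms on the left, none to \<open>c\<close>.
\<close>

lemma fl_diff_inner_residual:
  assumes K: "finite K" "card K + j \<le> n" and s: "fl_diff_inner u c K a b s"
    and w: "rounding_factor u j w" "y = s * w" and n: "real n * u < 1"
  shows "\<bar>c - ((\<Sum>k\<in>K. a k * b k) + y)\<bar> \<le> gamma_err n u * ((\<Sum>k\<in>K. \<bar>a k\<bar> * \<bar>b k\<bar>) + \<bar>y\<bar>)"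
proof -
  obtain t where t: "rounding_factor u (card K) t"
    and e: "\<bar>s * t - (c - (\<Sum>k\<in>K. a k * b k))\<bar> \<le> excess u (card K) * (\<Sum>k\<in>K. \<bar>a k\<bar> * \<bar>b k\<bar>)"
    using fl_diff_inner_error[OF K(1) s] by blast
  have ab: "0 \<le> (\<Sum>k\<in>K. \<bar>a k\<bar> * \<bar>b k\<bar>)" by (auto intro!: sum_nonneg)
  have g: "excess u k \<le> gamma_err n u" if "k \<le> n" for k
    using excess_mono[OF that] excess_le_gamma_err[OF n] by linarith
  have w0: "0 < w" using w(1) by (rule rounding_factor_pos)
  have "rounding_factor u (card K + j) (t * (1 / w))"
    by (intro rounding_factor_mult rounding_factor_inverse t w)
  then have "\<bar>t * (1 / w) - 1\<bar> \<le> gamma_err n u"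
    using rounding_factor_excess(1) g[OF K(2)] by fastforce
  moreover have "s * t - y = (t * (1 / w) - 1) * y" using w w0 by (simp add: field_simps)
  ultimately have 1: "\<bar>s * t - y\<bar> \<le> gamma_err n u * \<bar>y\<bar>" by (simp add: abs_mult mult_right_mono)
  have 2: "\<bar>s * t - (c - (\<Sum>k\<in>K. a k * b k))\<bar> \<le> gamma_err n u * (\<Sum>k\<in>K. \<bar>a k\<bar> * \<bar>b k\<bar>)"
    using e mult_right_mono[OF g ab, of "card K"] K(2) by auto
  show ?thesis using 1 2 by (simp add: algebra_simps abs_if split: if_splits)
qed

end

section \<open>Backward errors of triangular computations\<close>

lemma card_lessThan_less_CARD:
  "card {..<j :: 'n::{finite,linorder}} + 1 \<le> CARD('n)"
proof -
  have "{..<j} \<subset> UNIV" by auto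
  then show ?thesis using psubset_card_mono[of UNIV "{..<j}"] by simp
qed

lemma sum_lower_triangular:
  fixes f :: "'n::{finite,linorder} \<Rightarrow> real"
  assumes "\<And>k. j < k \<Longrightarrow> f k = 0"
  shows "(\<Sum>k\<in>UNIV. f k) = (\<Sum>k<j. f k) + f j"
proof -
  have "(\<Sum>k\<in>UNIV. f k) = (\<Sum>k\<in>insert j {..<j}. f k)"
    by (rule sum.mono_neutral_right) (auto intro!: assms)
  then show ?thesis by (simp add: add.commute)
qed

lemma fl_forward_subst_residual:
  fixes L :: "real^('n::{finite,linorder})^('n::{finite,linorder})"
  assumes u: "0 \<le> u" "u < 1" "real (CARD('n) + 1) * u < 1"
    and L: "\<And>i j. i < j \<Longrightarrow> L $ i $ j = 0" and X: "fl_forward_subst u L B X"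
  shows "\<bar>(B - L ** X) $ i $ j\<bar> \<le> gamma_err (CARD('n) + 1) u * (\<Sum>k\<in>UNIV. \<bar>L $ i $ k\<bar> * \<bar>X $ k $ j\<bar>)"
proof -
  obtain s where s: "fl_diff_inner u (B $ i $ j) {..<i} (\<lambda>k. L $ i $ k) (\<lambda>k. X $ k $ j) s"
    and Li: "L $ i $ i \<noteq> 0" "X $ i $ j \<in> fl u (s / L $ i $ i)"
    using X unfolding fl_forward_subst_def by blast
  obtain \<delta> where \<delta>: "\<bar>\<delta>\<bar> \<le> u" "L $ i $ i * X $ i $ j = s * (1 + \<delta>)"
    using Li by (auto simp: fl_def)
  have "card {..<i} + 1 \<le> CARD('n) + 1" using card_lessThan_less_CARD[of i] by linarith
  from fl_diff_inner_residual[OF u(1,2) _ this s rounding_factor_one_plus[OF u(1,2) \<delta>(1)] \<delta>(2) u(3)]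
  show ?thesis
    by (simp add: matrix_matrix_mult_def sum_lower_triangular[of i] L abs_mult)
qed

text \<open>
Off the diagonal an entry of \<open>L\<close> is obtained by one division. On the diagonal the relevant
quantity is the square of a rounded square root, which counts as two roundings; with at most
\<open>n - 1\<close> products this gives the index \<open>n + 1\<close>.
\<close>

lemma fl_cholesky_residual:
  fixes M :: "real^('n::{finite,linorder})^('n::{finite,linorder})"
  assumes u: "0 \<le> u" "u < 1" "real (CARD('n) + 1) * u < 1"
    and M: "transpose M = M" and L: "fl_cholesky u M L"
  shows "\<bar>(M - L ** transpose L) $ i $ j\<bar>
           \<le> gamma_err (CARD('n) + 1) u * (\<Sum>k\<in>UNIV. \<bar>L $ i $ k\<bar> * \<bar>L $ j $ k\<bar>)"
proof -
  have low: "\<And>i j. i < j \<Longrightarrow> L $ i $ j = 0" using L unfolding fl_cholesky_def by blast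
  have sym: "M $ i $ j = M $ j $ i" for i j
    using M by (metis transpose_def vec_lambda_beta)
  let ?P = "\<lambda>i j. \<bar>M $ i $ j - (\<Sum>k\<in>UNIV. L $ i $ k * L $ j $ k)\<bar>
           \<le> gamma_err (CARD('n) + 1) u * (\<Sum>k\<in>UNIV. \<bar>L $ i $ k\<bar> * \<bar>L $ j $ k\<bar>)"
  have off: "?P i j" if ji: "j < i" for i j
  proof -
    obtain s where s: "fl_diff_inner u (M $ i $ j) {..<j} (\<lambda>k. L $ i $ k) (\<lambda>k. L $ j $ k) s"
      and Lj: "L $ j $ j \<noteq> 0" "L $ i $ j \<in> fl u (s / L $ j $ j)"
      using L[unfolded fl_cholesky_def, THEN conjunct2, THEN conjunct2, rule_format, OF ji]
      by blast
    obtain \<delta> where \<delta>: "\<bar>\<delta>\<bar> \<le> u" "L $ i $ j * L $ j $ j = s * (1 + \<delta>)"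
      using Lj by (auto simp: fl_def)
    have "card {..<j} + 1 \<le> CARD('n) + 1" using card_lessThan_less_CARD[of j] by linarith
    from fl_diff_inner_residual[OF u(1,2) _ this s rounding_factor_one_plus[OF u(1,2) \<delta>(1)] \<delta>(2) u(3)]
    show ?thesis by (simp add: sum_lower_triangular[of j] low abs_mult)
  qed
  have diag: "?P j j" for j
  proof -
    obtain s where s: "fl_diff_inner u (M $ j $ j) {..<j} (\<lambda>k. L $ j $ k) (\<lambda>k. L $ j $ k) s"
      and Lj: "0 < s" "L $ j $ j \<in> fl u (sqrt s)"
      using L unfolding fl_cholesky_def by blast
    obtain \<delta> where \<delta>: "\<bar>\<delta>\<bar> \<le> u" "L $ j $ j = sqrt s * (1 + \<delta>)"
      using Lj by (auto simp: fl_def)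
    then have sq: "L $ j $ j * L $ j $ j = s * ((1 + \<delta>) * (1 + \<delta>))" using Lj(1) by simp
    note d = rounding_factor_one_plus[OF u(1,2) \<delta>(1)]
    have "card {..<j} + (1 + 1) \<le> CARD('n) + 1" using card_lessThan_less_CARD[of j] by linarith
    from fl_diff_inner_residual[OF u(1,2) _ this s rounding_factor_mult[OF u(1,2) d d] sq u(3)]
    show ?thesis by (simp add: sum_lower_triangular[of j] low abs_mult)
  qed
  have "?P i j"
  proof (cases i j rule: linorder_cases)
    case less
    then show ?thesis using off[OF less] sym[of i j] by (simp add: mult.commute)
  next
    case equal
    then show ?thesis using diag[of j] by simp
  next
    case greater
    then show ?thesis by (rule off)
  qed
  then show ?thesis by (simp add: matrix_matrix_mult_def transpose_def)
qed

section \<open>Spectral and Frobenius norm\<close>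

lemma norm_matrix_vector_le_spectral: "norm (M *v x) \<le> spectral_norm M * norm x"
  unfolding spectral_norm_def by (rule onorm) (rule matrix_vector_mul_bounded_linear)

lemma spectral_norm_nonneg: "0 \<le> spectral_norm M"
  unfolding spectral_norm_def by (rule onorm_pos_le) (rule matrix_vector_mul_bounded_linear)

lemma spectral_norm_leI:
  "(\<And>x. norm (M *v x) \<le> b * norm x) \<Longrightarrow> spectral_norm M \<le> b"
  unfolding spectral_norm_def by (rule onorm_le)

lemma spectral_norm_mult_le: "spectral_norm (M ** N) \<le> spectral_norm M * spectral_norm N"
proof (rule spectral_norm_leI)
  fix x
  have "norm (M *v (N *v x)) \<le> spectral_norm M * (spectral_norm N * norm x)"
    by (rule order_trans[OF norm_matrix_vector_le_spectral])
       (intro mult_left_mono norm_matrix_vector_le_spectral spectral_norm_nonneg)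
  then show "norm ((M ** N) *v x) \<le> spectral_norm M * spectral_norm N * norm x"
    by (simp add: matrix_vector_mul_assoc mult.assoc)
qed

lemma spectral_norm_add_le: "spectral_norm (M + N) \<le> spectral_norm M + spectral_norm N"
proof (rule spectral_norm_leI)
  fix x
  show "norm ((M + N) *v x) \<le> (spectral_norm M + spectral_norm N) * norm x"
    using norm_triangle_ineq[of "M *v x" "N *v x"]
      norm_matrix_vector_le_spectral[of M x] norm_matrix_vector_le_spectral[of N x]
    by (simp add: algebra_simps)
qed

lemma spectral_norm_minus_commute:
  "spectral_norm (M - N) = spectral_norm (N - M :: real^'n^'m)"
proof -
  have "(\<lambda>x. (M - N) *v x) = (\<lambda>x. - ((N - M) *v x))" by (simp add: algebra_simps)
  then show ?thesis unfolding spectral_norm_def by (simp only: onorm_neg)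
qed

lemma spectral_norm_diff_le:
  "spectral_norm (M - N) \<le> spectral_norm M + spectral_norm (N :: real^'n^'m)"
  using spectral_norm_add_le[of M "0 - N"] spectral_norm_minus_commute[of N 0] by simp

lemma inner_matrix_vector_transpose:
  "x \<bullet> (M *v y) = (transpose M *v x) \<bullet> (y :: real^'n)"
  by (metis dot_lmul_matrix transpose_transpose vector_transpose_matrix)

lemma spectral_norm_transpose_le: "spectral_norm (transpose M) \<le> spectral_norm (M :: real^'n^'m)"
proof (rule spectral_norm_leI)
  fix x
  let ?z = "transpose M *v x"
  have "norm ?z * norm ?z = x \<bullet> (M *v ?z)"
    using inner_matrix_vector_transpose[of x M ?z] power2_norm_eq_inner[of ?z]
    by (simp only: power2_eq_square)
  also have "\<dots> \<le> norm x * (spectral_norm M * norm ?z)"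
    by (rule order_trans[OF norm_cauchy_schwarz])
       (intro mult_left_mono norm_matrix_vector_le_spectral norm_ge_zero)
  also have "\<dots> = (spectral_norm M * norm x) * norm ?z" by (simp only: mult_ac)
  finally have le: "norm ?z * norm ?z \<le> (spectral_norm M * norm x) * norm ?z" .
  show "norm ?z \<le> spectral_norm M * norm x"
  proof (cases "norm ?z = 0")
    case True
    then show ?thesis by (simp only: True mult_nonneg_nonneg spectral_norm_nonneg norm_ge_zero)
  next
    case False
    then have "0 < norm ?z" by simp
    with le show ?thesis by (rule mult_right_le_imp_le)
  qed
qed

lemma spectral_norm_transpose: "spectral_norm (transpose M) = spectral_norm (M :: real^'n^'m)"
  using spectral_norm_transpose_le[of M] spectral_norm_transpose_le[of "transpose M"] by simp

text \<open>
The library norm on \<open>real^'n^'m\<close> is the Frobenius norm. It dominates the spectral norm and,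
unlike the latter, does not change when entries are replaced by their absolute values.
\<close>

lemma norm_matrix_squared: "(norm (M :: real^'n^'m))\<^sup>2 = (\<Sum>i\<in>UNIV. (norm (M $ i))\<^sup>2)"
  by (simp add: norm_vec_def L2_set_def sum_nonneg)

lemma norm_transpose: "norm (transpose M) = norm (M :: real^'n^'m)"
proof -
  have "(norm (transpose M))\<^sup>2 = (norm M)\<^sup>2"
    unfolding norm_matrix_squared
    by (simp add: norm_vec_def L2_set_def sum_nonneg transpose_def) (rule sum.swap)
  then show ?thesis by simp
qed

lemma spectral_norm_le_norm: "spectral_norm M \<le> norm (M :: real^'n^'m)"
proof (rule spectral_norm_leI)
  fix x
  have "(norm (M *v x))\<^sup>2 = (\<Sum>i\<in>UNIV. (M $ i \<bullet> x)\<^sup>2)"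
    by (simp add: norm_vec_def L2_set_def sum_nonneg matrix_vector_mul_component)
  also have "\<dots> \<le> (\<Sum>i\<in>UNIV. (norm (M $ i))\<^sup>2 * (norm x)\<^sup>2)"
    unfolding power2_norm_eq_inner by (intro sum_mono Cauchy_Schwarz_ineq)
  also have "\<dots> = (norm M * norm x)\<^sup>2"
    by (simp add: norm_matrix_squared power_mult_distrib sum_distrib_right)
  finally show "norm (M *v x) \<le> norm M * norm x"
    by (rule power2_le_imp_le) simp
qed

lemma norm_le_componentwise_product:
  fixes E :: "real^'n^'m" and M :: "real^'k^'m" and N :: "real^'k^'n"
  assumes "\<And>i j. \<bar>E $ i $ j\<bar> \<le> g * (\<Sum>k\<in>UNIV. \<bar>M $ i $ k\<bar> * \<bar>N $ j $ k\<bar>)" and g: "0 \<le> g"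
  shows "norm E \<le> g * norm M * norm N"
proof (rule power2_le_imp_le)
  have e: "(E $ i $ j)\<^sup>2 \<le> g\<^sup>2 * ((norm (M $ i))\<^sup>2 * (norm (N $ j))\<^sup>2)" for i j
  proof -
    have "(\<Sum>k\<in>UNIV. \<bar>M $ i $ k\<bar> * \<bar>N $ j $ k\<bar>) \<le> norm (M $ i) * norm (N $ j)"
      using L2_set_mult_ineq[of "\<lambda>k. M $ i $ k" "\<lambda>k. N $ j $ k" UNIV]
      by (simp only: norm_vec_def L2_set_def real_norm_def power2_abs)
    from order_trans[OF assms(1) mult_left_mono[OF this g]]
    have "\<bar>E $ i $ j\<bar>\<^sup>2 \<le> (g * (norm (M $ i) * norm (N $ j)))\<^sup>2"
      by (rule power_mono) simp
    then show ?thesis by (simp only: power2_abs power_mult_distrib)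
  qed
  have "(norm E)\<^sup>2 = (\<Sum>i\<in>UNIV. \<Sum>j\<in>UNIV. (E $ i $ j)\<^sup>2)"
    unfolding norm_matrix_squared by (simp add: norm_vec_def L2_set_def sum_nonneg)
  also have "\<dots> \<le> (\<Sum>i\<in>UNIV. \<Sum>j\<in>UNIV. g\<^sup>2 * ((norm (M $ i))\<^sup>2 * (norm (N $ j))\<^sup>2))"
    by (intro sum_mono e)
  also have "\<dots> = g\<^sup>2 * ((\<Sum>i\<in>UNIV. (norm (M $ i))\<^sup>2) * (\<Sum>j\<in>UNIV. (norm (N $ j))\<^sup>2))"
    by (simp only: sum_product sum_distrib_left[of "g\<^sup>2"])
  finally show "(norm E)\<^sup>2 \<le> (g * norm M * norm N)\<^sup>2"
    by (simp only: norm_matrix_squared[symmetric] power_mult_distrib mult.assoc)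
qed (use g in simp)

text \<open>
The squared Frobenius norm is the sum of \<open>CARD('m)\<close> values of the quadratic form of
\<open>M M\<^sup>T\<close> at unit vectors.
\<close>

lemma norm_matrix_le_sqrt:
  fixes M :: "real^'n^'m"
  assumes "\<And>x. (norm (transpose M *v x))\<^sup>2 \<le> c * (norm x)\<^sup>2"
  shows "norm M \<le> sqrt (real CARD('m) * c)"
proof -
  have "(norm M)\<^sup>2 = (\<Sum>i\<in>UNIV. (norm (transpose M *v axis i 1))\<^sup>2)"
    unfolding norm_matrix_squared
    by (simp add: matrix_vector_mult_basis column_def transpose_def)
  also have "\<dots> \<le> (\<Sum>i\<in>(UNIV::'m set). c * (norm (axis i 1 :: real^'m))\<^sup>2)"
    by (intro sum_mono assms)
  also have "\<dots> = real CARD('m) * c" by (simp add: norm_axis_1)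
  finally show ?thesis by (rule real_le_rsqrt)
qed

section \<open>Positive definite matrices\<close>

lemma pos_def_invertible:
  assumes "pos_def (M :: real^'n^'n)"
  shows "invertible M"
proof -
  have "x = 0" if "M *v x = 0" for x
    using assms that unfolding pos_def_def by (metis inner_zero_right less_irrefl)
  then show ?thesis by (simp add: invertible_left_inverse matrix_left_invertible_ker)
qed

lemma matrix_inv_mult:
  assumes "invertible (M :: real^'n^'n)"
  shows "matrix_inv M ** M = mat 1" "M ** matrix_inv M = mat 1"
  using someI_ex[OF assms[unfolded invertible_def]] unfolding matrix_inv_def by blast+

lemma matrix_inv_eqI:
  assumes "M ** N = mat 1" 
  shows "matrix_inv (M :: real^'n^'n) = N"
proof -
  have "invertible M" using assms invertible_right_inverse by blast
  then have "matrix_inv M ** (M ** N) = N"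
    by (simp add: matrix_mul_assoc matrix_inv_mult)
  then show ?thesis by (simp add: assms)
qed

text \<open>
The least eigenvalue of \<open>M\<close> is the reciprocal of the norm of its inverse. Instead of the
spectral theorem the proof uses the positivity of the form at a single vector.
\<close>

lemma pos_def_lower_bound:
  fixes M :: "real^'n^'n"
  assumes pd: "pos_def M" and sym: "transpose M = M"
  shows "(norm x)\<^sup>2 \<le> spectral_norm (matrix_inv M) * (x \<bullet> (M *v x))"
proof (cases "x = 0")
  case False
  define b where "b = spectral_norm (matrix_inv M)"
  define z where "z = matrix_inv M *v x"
  have Mz: "M *v z = x"
    by (simp add: z_def matrix_vector_mul_assoc matrix_inv_mult pos_def_invertible[OF pd])
  have "z \<bullet> x \<le> norm z * norm x" by (rule norm_cauchy_schwarz)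
  also have "\<dots> \<le> (b * norm x) * norm x"
    unfolding z_def b_def by (intro mult_right_mono norm_matrix_vector_le_spectral norm_ge_zero)
  finally have zx: "z \<bullet> x \<le> b * (norm x)\<^sup>2" by (simp add: power2_eq_square)
  have "z \<noteq> 0" using Mz False by auto
  then have "0 < z \<bullet> x" using pd Mz unfolding pos_def_def by metis
  then have b: "0 < b" using zx False 
    by (smt (verit) mult_nonpos_nonneg zero_le_power2)
  \<comment> \<open>The multiple 1 / b of z minimizes the resulting bound, as in the proof of the
    Cauchy--Schwarz inequality for the form of M.\<close>
  have "0 \<le> (x - (1 / b) *\<^sub>R z) \<bullet> (M *v (x - (1 / b) *\<^sub>R z))"
    using pd unfolding pos_def_def by (metis inner_zero_left less_eq_real_def)
  also have "\<dots> = x \<bullet> (M *v x) - 2 / b * (norm x)\<^sup>2 + (1 / b)\<^sup>2 * (z \<bullet> x)"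
  proof -
    have "z \<bullet> (M *v x) = x \<bullet> x" by (simp add: inner_matrix_vector_transpose sym Mz)
    then show ?thesis
      by (simp add: algebra_simps Mz dot_square_norm inner_commute power2_eq_square)
  qed
  also have "\<dots> \<le> x \<bullet> (M *v x) - 2 / b * (norm x)\<^sup>2 + (1 / b)\<^sup>2 * (b * (norm x)\<^sup>2)"
    using zx by (intro add_left_mono mult_left_mono) auto
  also have "\<dots> = x \<bullet> (M *v x) - (norm x)\<^sup>2 / b"
    using b by (simp add: field_simps power2_eq_square)
  finally show ?thesis using b by (simp add: field_simps b_def)
qed simp

lemma spectral_norm_inverse_ge:
  assumes "invertible (M :: real^'n^'n)"
  shows "1 \<le> spectral_norm M * spectral_norm (matrix_inv M)"
proof -
  have "spectral_norm (mat 1 :: real^'n^'n) = 1"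
    unfolding spectral_norm_def using onorm_id[where 'a = "real^'n"]
    by (simp add: matrix_vector_mul_lid[abs_def])
  then show ?thesis
    using spectral_norm_mult_le[of M "matrix_inv M"] by (simp add: matrix_inv_mult[OF assms])
qed

lemma pos_def_factor_invertible:
  assumes "pos_def (L ** transpose L)"
  shows "invertible (L :: real^'n^'n)"
proof -
  from pos_def_invertible[OF assms] obtain N where "(L ** transpose L) ** N = mat 1"
    unfolding invertible_right_inverse by blast
  then have "L ** (transpose L ** N) = mat 1" by (simp add: matrix_mul_assoc)
  then show ?thesis unfolding invertible_right_inverse by blast
qed

section \<open>Block matrices\<close>

definition join_vec :: "real^'n \<Rightarrow> real^'n \<Rightarrow> real^('n + 'n)" where
  "join_vec x y = (\<chi> i. case i of Inl a \<Rightarrow> x $ a | Inr b \<Rightarrow> y $ b)"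

lemma sum_UNIV_sum:
  fixes f :: "'a::finite + 'b::finite \<Rightarrow> 'c::comm_monoid_add"
  shows "(\<Sum>i\<in>UNIV. f i) = (\<Sum>a\<in>UNIV. f (Inl a)) + (\<Sum>b\<in>UNIV. f (Inr b))"
  by (subst UNIV_Plus_UNIV[symmetric]) (simp add: sum.Plus del: UNIV_Plus_UNIV)

lemma join_vec_surj: "\<exists>x y. z = join_vec x y"
  by (rule exI[of _ "\<chi> a. z $ Inl a"], rule exI[of _ "\<chi> b. z $ Inr b"])
     (simp add: join_vec_def vec_eq_iff split: sum.split)

lemma join_vec_eq_0_iff: "join_vec x y = 0 \<longleftrightarrow> x = 0 \<and> y = 0"
  by (auto simp: join_vec_def vec_eq_iff split: sum.split_asm sum.split)

lemma inner_join_vec: "join_vec x y \<bullet> join_vec x' y' = x \<bullet> x' + y \<bullet> y'"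
  by (simp add: inner_vec_def sum_UNIV_sum join_vec_def)

lemma norm_join_vec: "(norm (join_vec x y))\<^sup>2 = (norm x)\<^sup>2 + (norm y)\<^sup>2"
  by (simp add: power2_norm_eq_inner inner_join_vec)

lemma join_vec_add: "join_vec (x + x') (y + y') = join_vec x y + join_vec x' y'"
  by (simp add: join_vec_def vec_eq_iff split: sum.split)

lemma block_mat_mult_join_vec:
  "block_mat P Q R T *v join_vec x y = join_vec (P *v x + Q *v y) (R *v x + T *v y)"
  by (simp add: block_mat_def join_vec_def vec_eq_iff matrix_vector_mult_def sum_UNIV_sum
      split: sum.split)

lemma block_mat_mult:
  "block_mat P Q R T ** block_mat P' Q' R' T' =
   block_mat (P ** P' + Q ** R') (P ** Q' + Q ** T') (R ** P' + T ** R') (R ** Q' + T ** T')"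
  by (simp add: block_mat_def vec_eq_iff matrix_matrix_mult_def sum_UNIV_sum split: sum.split)

lemma transpose_block_mat:
  "transpose (block_mat P Q R T) =
   block_mat (transpose P) (transpose R) (transpose Q) (transpose T)"
  by (simp add: block_mat_def vec_eq_iff transpose_def split: sum.split)

lemma block_mat_diff:
  "block_mat P Q R T - block_mat P' Q' R' T' = block_mat (P - P') (Q - Q') (R - R') (T - T')"
  by (simp add: block_mat_def vec_eq_iff split: sum.split)

lemma block_mat_eqD:
  assumes "block_mat P Q R T = block_mat P' Q' R' T'"
  shows "P = P'"
proof -
  have "P $ a $ b = P' $ a $ b" for a b
    using arg_cong[OF assms, of "\<lambda>M. M $ Inl a $ Inl b"] by (simp add: block_mat_def)
  then show ?thesis by (simp add: vec_eq_iff)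
qed

lemma spectral_norm_block_diag_le:
  fixes P :: "real^'n^'n"
  shows "spectral_norm P \<le> spectral_norm (block_mat P Q R T)"
    "spectral_norm T \<le> spectral_norm (block_mat P Q R T)"
proof -
  let ?M = "block_mat P Q R T"
  have ge: "norm x \<le> norm (join_vec x y)" "norm y \<le> norm (join_vec x y)" for x y :: "real^'n"
    by (rule power2_le_imp_le; simp add: norm_join_vec)+
  have eq: "norm (join_vec x 0) = norm x" "norm (join_vec 0 x) = norm x" for x :: "real^'n"
    by (rule power2_eq_imp_eq; simp add: norm_join_vec)+
  show "spectral_norm P \<le> spectral_norm ?M"
  proof (rule spectral_norm_leI)
    fix x
    show "norm (P *v x) \<le> spectral_norm ?M * norm x"
      using norm_matrix_vector_le_spectral[of ?M "join_vec x 0"] ge(1)[of "P *v x" "R *v x"]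
      by (simp add: block_mat_mult_join_vec eq)
  qed
  show "spectral_norm T \<le> spectral_norm ?M"
  proof (rule spectral_norm_leI)
    fix x
    show "norm (T *v x) \<le> spectral_norm ?M * norm x"
      using norm_matrix_vector_le_spectral[of ?M "join_vec 0 x"] ge(2)[of "T *v x" "Q *v x"]
      by (simp add: block_mat_mult_join_vec eq)
  qed
qed

text \<open>
Split the matrix into its upper left block, its antidiagonal part and its lower right block; the
antidiagonal part has the norm of \<open>Q\<close> and not twice that norm, because its two blocks act on
orthogonal components.
\<close>

lemma spectral_norm_block_mat_le:
  fixes P :: "real^'n^'n"
  shows "spectral_norm (block_mat P Q (transpose Q) T)
     \<le> spectral_norm P + spectral_norm Q + spectral_norm T"
proof (rule spectral_norm_leI)
  fix z :: "real^('n + 'n)"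
  obtain x y where z: "z = join_vec x y" using join_vec_surj by blast
  have le: "norm (join_vec v w) \<le> c * norm z"
    if "norm v \<le> c * norm s" "norm w \<le> c * norm t" "0 \<le> c"
       "(norm s)\<^sup>2 + (norm t)\<^sup>2 \<le> (norm z)\<^sup>2" for v w s t :: "real^'n" and c
  proof (rule power2_le_imp_le)
    have "(norm (join_vec v w))\<^sup>2 \<le> (c * norm s)\<^sup>2 + (c * norm t)\<^sup>2"
      unfolding norm_join_vec using that by (intro add_mono power_mono) auto
    also have "\<dots> = c\<^sup>2 * ((norm s)\<^sup>2 + (norm t)\<^sup>2)" by (simp add: algebra_simps)
    also have "\<dots> \<le> (c * norm z)\<^sup>2"
      using that(4) by (simp add: power_mult_distrib mult_left_mono)
    finally show "(norm (join_vec v w))\<^sup>2 \<le> (c * norm z)\<^sup>2" .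
  qed (use that in simp)
  have 1: "norm (join_vec (P *v x) 0) \<le> spectral_norm P * norm z"
    by (rule le[of _ _ x _ 0])
       (auto simp: norm_matrix_vector_le_spectral spectral_norm_nonneg z norm_join_vec)
  have 2: "norm (join_vec (Q *v y) (transpose Q *v x)) \<le> spectral_norm Q * norm z"
    using norm_matrix_vector_le_spectral[of "transpose Q" x]
    by (intro le[of _ _ y _ x])
       (auto simp: norm_matrix_vector_le_spectral spectral_norm_nonneg z norm_join_vec spectral_norm_transpose)
  have 3: "norm (join_vec 0 (T *v y)) \<le> spectral_norm T * norm z"
    by (rule le[of _ _ 0 _ y])
       (auto simp: norm_matrix_vector_le_spectral spectral_norm_nonneg z norm_join_vec)
  have "block_mat P Q (transpose Q) T *v z =
      join_vec (P *v x) 0 + join_vec (Q *v y) (transpose Q *v x) + join_vec 0 (T *v y)"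
    by (simp add: z block_mat_mult_join_vec flip: join_vec_add)
  then have "norm (block_mat P Q (transpose Q) T *v z) \<le>
      norm (join_vec (P *v x) 0) + norm (join_vec (Q *v y) (transpose Q *v x)) + norm (join_vec 0 (T *v y))"
    using norm_triangle_ineq[of "join_vec (P *v x) 0 + join_vec (Q *v y) (transpose Q *v x)" "join_vec 0 (T *v y)"]
      norm_triangle_ineq[of "join_vec (P *v x) 0" "join_vec (Q *v y) (transpose Q *v x)"] by simp
  then show "norm (block_mat P Q (transpose Q) T *v z)
      \<le> (spectral_norm P + spectral_norm Q + spectral_norm T) * norm z"
    using 1 2 3 by (simp add: algebra_simps)
qed

section \<open>Positive definite block matrices\<close>

lemma pos_def_leading_block:
  assumes "pos_def (block_mat P Q R T)"
  shows "pos_def P"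
  using assms[unfolded pos_def_def, rule_format, of "join_vec _ 0"]
  by (simp_all add: pos_def_def join_vec_eq_0_iff block_mat_mult_join_vec inner_join_vec)

text \<open>
The Schur complement of a positive definite matrix is positive semidefinite: evaluate the form
of the block matrix at \<open>(- y, x)\<close>, its minimizer over the first component for symmetric \<open>P\<close>.
\<close>

lemma pos_def_block_schur_bound:
  assumes pd: "pos_def (block_mat P Q (transpose Q) T)"
    and y: "P *v y = Q *v x"
  shows "y \<bullet> (P *v y) \<le> spectral_norm T * (norm x)\<^sup>2"
proof -
  have "0 \<le> join_vec (- y) x \<bullet> (block_mat P Q (transpose Q) T *v join_vec (- y) x)"
    using pd unfolding pos_def_def by (metis inner_zero_left less_eq_real_def)
  also have "\<dots> = y \<bullet> (P *v y) - y \<bullet> (Q *v x) - x \<bullet> (transpose Q *v y) + x \<bullet> (T *v x)"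
    by (simp add: block_mat_mult_join_vec inner_join_vec algebra_simps vec.neg)
  also have "x \<bullet> (transpose Q *v y) = y \<bullet> (Q *v x)"
    by (simp add: inner_matrix_vector_transpose inner_commute)
  finally have "y \<bullet> (P *v y) \<le> x \<bullet> (T *v x)" by (simp add: y)
  also have "\<dots> \<le> norm x * (spectral_norm T * norm x)"
    by (rule order_trans[OF norm_cauchy_schwarz])
       (intro mult_left_mono norm_matrix_vector_le_spectral norm_ge_zero)
  finally show ?thesis by (simp add: power2_eq_square mult_ac)
qed

text \<open>
The naive bound by the norms of the inverse of \<open>P\<close> and of \<open>Q\<close> would make the final estimate quadratic in the
condition number. Factoring through the form of \<open>P\<close> yields only the square root of the norm
of the inverse.
\<close>

lemma spectral_norm_inv_times_block:
  assumes pd: "pos_def (block_mat P Q (transpose Q) T)" and sym: "transpose P = P"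
  shows "spectral_norm (matrix_inv P ** Q) \<le> sqrt (spectral_norm (matrix_inv P) * spectral_norm T)"
proof (rule spectral_norm_leI)
  fix x
  define y where "y = (matrix_inv P ** Q) *v x"
  note P = pos_def_leading_block[OF pd]
  have Py: "P *v y = Q *v x"
    by (simp add: y_def matrix_vector_mul_assoc matrix_mul_assoc matrix_inv_mult pos_def_invertible[OF P])
  have "(norm y)\<^sup>2 \<le> spectral_norm (matrix_inv P) * (y \<bullet> (P *v y))"
    by (rule pos_def_lower_bound[OF P sym])
  also have "\<dots> \<le> spectral_norm (matrix_inv P) * (spectral_norm T * (norm x)\<^sup>2)"
    by (intro mult_left_mono pos_def_block_schur_bound[OF pd Py] spectral_norm_nonneg)
  finally have "norm y \<le> sqrt (spectral_norm (matrix_inv P) * (spectral_norm T * (norm x)\<^sup>2))"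
    by (rule real_le_rsqrt)
  then show "norm ((matrix_inv P ** Q) *v x)
      \<le> sqrt (spectral_norm (matrix_inv P) * spectral_norm T) * norm x"
    by (simp add: y_def real_sqrt_mult)
qed

section \<open>Perturbation of inverses, Schur complements and Gram matrices\<close>

lemma matrix_diff_ldistrib: "M ** (N - K) = M ** N - M ** (K :: real^'n^'m)"
  by (simp add: vec_eq_iff matrix_matrix_mult_def sum_subtractf algebra_simps)

lemma matrix_diff_rdistrib: "(M - N) ** K = M ** K - N ** (K :: real^'n^'m)"
  by (simp add: vec_eq_iff matrix_matrix_mult_def sum_subtractf algebra_simps)

lemma transpose_diff: "transpose (M - N) = transpose M - transpose (N :: real^'n^'m)"
  by (simp add: vec_eq_iff transpose_def)

lemma inverse_perturbation:
  fixes P P' :: "real^'n^'n"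
  assumes P: "invertible P" and P': "invertible P'"
  shows "spectral_norm (matrix_inv P' - matrix_inv P)
           \<le> spectral_norm (matrix_inv P) * spectral_norm (P - P') * spectral_norm (matrix_inv P')"
proof -
  have "matrix_inv P ** (P - P') ** matrix_inv P' = matrix_inv P' - matrix_inv P"
    by (simp add: matrix_diff_ldistrib matrix_diff_rdistrib matrix_inv_mult[OF P]
        matrix_inv_mult[OF P'] flip: matrix_mul_assoc)
  then have "spectral_norm (matrix_inv P' - matrix_inv P)
      \<le> spectral_norm (matrix_inv P ** (P - P')) * spectral_norm (matrix_inv P')"
    by (metis spectral_norm_mult_le)
  also have "\<dots> \<le> spectral_norm (matrix_inv P) * spectral_norm (P - P') * spectral_norm (matrix_inv P')"
    by (intro mult_right_mono spectral_norm_mult_le spectral_norm_nonneg)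
  finally show ?thesis .
qed

text \<open>
With \<open>P Y = Q\<close> and \<open>P' Y' = Q'\<close> the claim concerns \<open>Q'\<^sup>T Y' - Q\<^sup>T Y\<close> only; the
mixed terms cancel because \<open>Y\<^sup>T P Y' = Q\<^sup>T Y'\<close> and \<open>Y\<^sup>T P' Y' = Y\<^sup>T Q'\<close>. The identity is exact, so no
second-order terms have to be discarded.
\<close>

lemma schur_complement_diff:
  fixes P P' Q Q' T :: "real^'n^'n"
  assumes P: "invertible P" "transpose P = P" and P': "invertible P'"
  defines "Y \<equiv> matrix_inv P ** Q" and "Y' \<equiv> matrix_inv P' ** Q'"
  shows "schur_complement P' Q' T - schur_complement P Q T =
    transpose (Q - Q') ** Y' + transpose Y ** (Q - Q') - transpose Y ** (P - P') ** Y'"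
proof -
  have PY: "P ** Y = Q" "P' ** Y' = Q'"
    by (simp_all add: Y_def Y'_def matrix_mul_assoc matrix_inv_mult P P')
  have YP: "transpose Y ** P = transpose Q"
    using arg_cong[OF PY(1), of transpose] by (simp add: matrix_transpose_mul P)
  have "transpose Y ** Q = transpose Q ** Y"
    unfolding YP[symmetric] by (simp add: PY flip: matrix_mul_assoc)
  moreover have "transpose Y ** P ** Y' = transpose Q ** Y'" by (simp add: YP)
  moreover have "transpose Y ** P' ** Y' = transpose Y ** Q'" by (simp add: PY flip: matrix_mul_assoc)
  moreover have "schur_complement P Q T = T - transpose Q ** Y"
    "schur_complement P' Q' T = T - transpose Q' ** Y'"
    by (simp_all add: schur_complement_def Y_def Y'_def matrix_mul_assoc)
  ultimately show ?thesis
    by (simp add: matrix_diff_ldistrib matrix_diff_rdistrib transpose_diff)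
qed

lemma spectral_norm_mult_mono:
  assumes "spectral_norm (M :: real^'k^'m) \<le> a" "spectral_norm (N :: real^'n^'k) \<le> b"
  shows "spectral_norm (M ** N) \<le> a * b"
proof -
  have "0 \<le> a" using assms(1) spectral_norm_nonneg order_trans by blast
  then show ?thesis
    using assms by (intro order_trans[OF spectral_norm_mult_le] mult_mono spectral_norm_nonneg)
qed

lemma schur_complement_perturbation:
  fixes P P' Q Q' T :: "real^'n^'n"
  assumes P: "invertible P" "transpose P = P" and P': "invertible P'"
    and Y: "spectral_norm (matrix_inv P ** Q) \<le> h" and Y': "spectral_norm (matrix_inv P' ** Q') \<le> h"
    and dP: "spectral_norm (P - P') \<le> p" and dQ: "spectral_norm (Q - Q') \<le> q"
  shows "spectral_norm (schur_complement P' Q' T - schur_complement P Q T) \<le> 2 * q * h + p * h\<^sup>2"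
proof -
  let ?Y = "matrix_inv P ** Q" and ?Y' = "matrix_inv P' ** Q'"
  have 1: "spectral_norm (transpose (Q - Q') ** ?Y') \<le> q * h"
    using dQ Y' by (intro spectral_norm_mult_mono) (simp_all only: spectral_norm_transpose)
  have 2: "spectral_norm (transpose ?Y ** (Q - Q')) \<le> h * q"
    using dQ Y by (intro spectral_norm_mult_mono) (simp_all only: spectral_norm_transpose)
  have 3: "spectral_norm (transpose ?Y ** (P - P') ** ?Y') \<le> h * p * h"
    using dP Y Y' by (intro spectral_norm_mult_mono) (simp_all only: spectral_norm_transpose)
  have "spectral_norm (schur_complement P' Q' T - schur_complement P Q T)
      \<le> q * h + h * q + h * p * h"
    unfolding schur_complement_diff[OF P P']
    by (intro order_trans[OF spectral_norm_diff_le] order_trans[OF spectral_norm_add_le] add_mono 1 2 3)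
  then show ?thesis by (simp add: power2_eq_square mult_ac)
qed

lemma matrix_inv_gram:
  assumes "invertible (L :: real^'n^'n)"
  shows "matrix_inv (L ** transpose L) = transpose (matrix_inv L) ** matrix_inv L"
proof (rule matrix_inv_eqI)
  have "(L ** transpose L) ** (transpose (matrix_inv L) ** matrix_inv L)
      = L ** transpose (matrix_inv L ** L) ** matrix_inv L"
    by (simp only: matrix_transpose_mul matrix_mul_assoc)
  then show "(L ** transpose L) ** (transpose (matrix_inv L) ** matrix_inv L) = mat 1"
    by (simp add: matrix_inv_mult[OF assms])
qed

lemma norm_transpose_vector_squared:
  "(norm (transpose L *v x))\<^sup>2 = x \<bullet> ((L ** transpose L) *v (x :: real^'n))"
  using inner_matrix_vector_transpose[of x L "transpose L *v x"]
  by (simp only: power2_norm_eq_inner matrix_vector_mul_assoc)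

lemma inner_le_spectral_norm: "x \<bullet> (M *v x) \<le> spectral_norm M * (norm (x :: real^'n))\<^sup>2"
proof -
  have "x \<bullet> (M *v x) \<le> norm x * (spectral_norm M * norm x)"
    by (rule order_trans[OF norm_cauchy_schwarz])
       (intro mult_left_mono norm_matrix_vector_le_spectral norm_ge_zero)
  then show ?thesis by (simp only: power2_eq_square mult_ac)
qed

lemma norm_gram_factor_le:
  "norm (L :: real^'n^'n) \<le> sqrt (real CARD('n) * spectral_norm (L ** transpose L))"
  by (rule norm_matrix_le_sqrt) (simp only: norm_transpose_vector_squared inner_le_spectral_norm)

lemma schur_complement_gram:
  fixes L K T :: "real^'n^'n"
  assumes "invertible L"
  shows "schur_complement (L ** transpose L) (L ** transpose K) T = T - K ** transpose K"
proof -
  let ?J = "matrix_inv L"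
  have "transpose (L ** transpose K) ** (transpose ?J ** ?J) ** (L ** transpose K)
      = K ** transpose (?J ** L) ** (?J ** L) ** transpose K"
    by (simp only: matrix_transpose_mul matrix_mul_assoc transpose_transpose)
  then show ?thesis
    by (simp add: schur_complement_def matrix_inv_gram[OF assms] matrix_inv_mult[OF assms])
qed

text \<open>
Here \<open>K K\<^sup>T\<close> equals \<open>Q\<^sup>T P\<^sup>-\<^sup>1 Q\<close> with \<open>P = L L\<^sup>T\<close> and \<open>Q = L K\<^sup>T\<close>, which positive definiteness
bounds by \<open>T\<close>.
\<close>

lemma norm_offdiagonal_factor_le:
  fixes L K T :: "real^'n^'n"
  assumes pd: "pos_def (block_mat (L ** transpose L) (L ** transpose K) (transpose (L ** transpose K)) T)"
  shows "norm K \<le> sqrt (real CARD('n) * spectral_norm T)"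
proof (rule norm_matrix_le_sqrt)
  fix x
  have L: "invertible L" by (rule pos_def_factor_invertible[OF pos_def_leading_block[OF pd]])
  define y where "y = transpose (matrix_inv L) *v (transpose K *v x)"
  have "transpose L ** transpose (matrix_inv L) = mat 1"
    by (simp add: matrix_inv_mult[OF L] flip: matrix_transpose_mul)
  then have Ly: "transpose L *v y = transpose K *v x"
    by (simp only: y_def matrix_vector_mul_assoc[of "transpose L"] matrix_vector_mul_lid)
  then have "(L ** transpose L) *v y = (L ** transpose K) *v x"
    by (simp flip: matrix_vector_mul_assoc)
  from pos_def_block_schur_bound[OF pd this]
  show "(norm (transpose K *v x))\<^sup>2 \<le> spectral_norm T * (norm x)\<^sup>2"
    by (simp only: norm_transpose_vector_squared[of L, symmetric] Ly)
qed

text \<open>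
A matrix with residual \<open>E = I - L X\<close> is \<open>L\<^sup>-\<^sup>1 (I - E)\<close>, so its Gram matrix is
\<open>(I - E)\<^sup>T G (I - E)\<close>. The second bound is needed because the residual is itself estimated
through the norm of \<open>X\<close>.
\<close>

lemma approximate_inverse_gram:
  fixes L X :: "real^'n^'n"
  assumes L: "invertible L"
  defines "e \<equiv> spectral_norm (mat 1 - L ** X)"
    and "G \<equiv> matrix_inv (L ** transpose L)"
  shows "spectral_norm (transpose X ** X - G) \<le> spectral_norm G * (2 * e + e\<^sup>2)"
    and "norm X \<le> sqrt (real CARD('n) * spectral_norm G) * (1 + e)"
proof -
  define E where "E = mat 1 - L ** X"
  define J where "J = matrix_inv L"
  have e: "e = spectral_norm E" "0 \<le> e" by (simp_all add: e_def E_def spectral_norm_nonneg)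
  have G: "G = transpose J ** J" by (simp add: G_def J_def matrix_inv_gram[OF L])
  have LX: "L ** X = mat 1 - E" by (simp add: E_def)
  have "J ** (L ** X) = X" by (simp add: J_def matrix_mul_assoc matrix_inv_mult[OF L])
  then have X: "X = J ** (mat 1 - E)" by (simp only: LX)
  have XX: "transpose X ** X = transpose (mat 1 - E) ** G ** (mat 1 - E)"
    unfolding X G by (simp only: matrix_transpose_mul matrix_mul_assoc)
  have eq: "transpose X ** X - G = transpose E ** G ** E - (transpose E ** G + G ** E)"
    unfolding XX by (simp add: transpose_diff matrix_diff_ldistrib matrix_diff_rdistrib)
  have EG: "spectral_norm (transpose E ** G) \<le> e * spectral_norm G"
    using spectral_norm_mult_le[of "transpose E" G] by (simp add: spectral_norm_transpose e)
  moreover have "spectral_norm (G ** E) \<le> spectral_norm G * e"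
    using spectral_norm_mult_le[of G E] by (simp add: e)
  moreover have "spectral_norm (transpose E ** G ** E) \<le> e * spectral_norm G * e"
    by (rule order_trans[OF spectral_norm_mult_le])
       (use EG e in \<open>auto intro!: mult_right_mono\<close>)
  ultimately have "spectral_norm (transpose X ** X - G)
      \<le> e * spectral_norm G * e + (e * spectral_norm G + spectral_norm G * e)"
    using spectral_norm_diff_le[of "transpose E ** G ** E" "transpose E ** G + G ** E"]
      spectral_norm_add_le[of "transpose E ** G" "G ** E"] EG unfolding eq by linarith
  then show "spectral_norm (transpose X ** X - G) \<le> spectral_norm G * (2 * e + e\<^sup>2)"
    by (simp add: power2_eq_square algebra_simps)
  have "norm (transpose X) \<le> sqrt (real CARD('n) * (spectral_norm G * (1 + e)\<^sup>2))"
  proof (rule norm_matrix_le_sqrt)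
    fix x :: "real^'n"
    let ?v = "(mat 1 - E) *v x"
    have Gv: "(norm (J *v v))\<^sup>2 = v \<bullet> (G *v v)" for v
      using norm_transpose_vector_squared[of "transpose J" v] by (simp add: G)
    have "norm ?v \<le> norm x + norm (E *v x)"
      using norm_triangle_ineq4[of x "E *v x"] by (simp add: matrix_vector_mult_diff_rdistrib)
    also have "\<dots> \<le> (1 + e) * norm x"
      using norm_matrix_vector_le_spectral[of E x] by (simp add: e algebra_simps)
    finally have v: "norm ?v \<le> (1 + e) * norm x" .
    have "(norm (X *v x))\<^sup>2 = ?v \<bullet> (G *v ?v)"
      by (simp add: X Gv flip: matrix_vector_mul_assoc)
    also have "\<dots> \<le> spectral_norm G * (norm ?v)\<^sup>2" by (rule inner_le_spectral_norm)
    also have "\<dots> \<le> spectral_norm G * ((1 + e) * norm x)\<^sup>2"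
      by (intro mult_left_mono power_mono v spectral_norm_nonneg norm_ge_zero)
    finally show "(norm (transpose (transpose X) *v x))\<^sup>2 \<le> spectral_norm G * (1 + e)\<^sup>2 * (norm x)\<^sup>2"
      by (simp add: power_mult_distrib mult.assoc)
  qed
  then show "norm X \<le> sqrt (real CARD('n) * spectral_norm G) * (1 + e)"
    using e(2) by (simp add: norm_transpose real_sqrt_mult)
qed

section \<open>First-order bounds with explicit remainders\<close>

lemma sqrt_le_self: "1 \<le> (z :: real) \<Longrightarrow> sqrt z \<le> z"
  by (rule real_le_lsqrt) (auto intro: power_increasing[of 1 2 z, simplified])

text \<open>
The norms \<open>a'\<close>, \<open>b'\<close> of the perturbed block and of its inverse enter their own estimates. For
small \<open>y\<close> the implicit inequalities can be solved by \<open>1 / (1 - t) \<le> 1 + 2 * t\<close>. The factor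
\<open>6\<close> and the coefficients of \<open>y\<^sup>2\<close> below have no significance beyond being large enough.
\<close>

lemma perturbed_norm_scalar_bounds:
  fixes a b x a' b' :: real
  defines "y \<equiv> x * (a * b)"
  assumes nn: "0 \<le> a" "0 \<le> b" "0 \<le> x" "0 \<le> a'" "0 \<le> b'"
    and ab: "1 \<le> a * b" and y: "y \<le> 1 / 16"
    and a': "a' \<le> a + x * a'" and b': "b' \<le> b + b * (x * a') * b'"
  shows "a' \<le> a * (1 + 6 * y)" "b' \<le> b * (1 + 6 * y)"
proof -
  have y0: "0 \<le> y" using nn by (simp add: y_def)
  have xy: "x \<le> y" using nn ab mult_left_mono[of 1 "a * b" x] by (simp add: y_def)
  have "a' * (1 - x) \<le> a" using a' by (simp add: algebra_simps)
  also have "a * 1 \<le> a * ((1 + 2 * x) * (1 - x))"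
  proof (rule mult_left_mono[OF _ nn(1)])
    have "0 \<le> x * (1 - 2 * x)" using nn xy y by (intro mult_nonneg_nonneg) auto
    then show "1 \<le> (1 + 2 * x) * (1 - x)" by (simp add: algebra_simps)
  qed
  finally have "a' * (1 - x) \<le> a * (1 + 2 * x) * (1 - x)" by (simp add: mult.assoc)
  then have "a' \<le> a * (1 + 2 * x)" by (rule mult_right_le_imp_le) (use xy y in linarith)
  also have "\<dots> \<le> a * (1 + 6 * y)" using nn xy y0 by (intro mult_left_mono) auto
  finally show A: "a' \<le> a * (1 + 6 * y)" .
  define w where "w = 2 * y"
  have "b * (x * a') \<le> b * (x * (a * (1 + 6 * y)))"
    using A nn by (intro mult_left_mono) auto
  also have "\<dots> = y * (1 + 6 * y)" by (simp add: y_def)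
  also have "\<dots> \<le> y * 2" using y y0 by (intro mult_left_mono) auto
  finally have "b * (x * a') * b' \<le> w * b'" using nn by (intro mult_right_mono) (auto simp: w_def)
  then have "b' * (1 - w) \<le> b" using b' by (simp add: algebra_simps)
  also have "b * 1 \<le> b * ((1 + 2 * w) * (1 - w))"
  proof (rule mult_left_mono[OF _ nn(2)])
    have "0 \<le> w * (1 - 2 * w)" using y0 y by (intro mult_nonneg_nonneg) (auto simp: w_def)
    then show "1 \<le> (1 + 2 * w) * (1 - w)" by (simp add: algebra_simps)
  qed
  finally have "b' * (1 - w) \<le> b * (1 + 2 * w) * (1 - w)" by (simp add: mult.assoc)
  then have "b' \<le> b * (1 + 2 * w)" by (rule mult_right_le_imp_le) (use y in \<open>simp add: w_def\<close>)
  also have "\<dots> \<le> b * (1 + 6 * y)" using nn y0 by (intro mult_left_mono) (auto simp: w_def)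
  finally show "b' \<le> b * (1 + 6 * y)" .
qed

lemma second_order_factor:
  fixes y :: real
  assumes "0 \<le> y" "y \<le> 1 / 16"
  shows "y * (1 + 6 * y)\<^sup>2 \<le> y + 15 * y\<^sup>2"
proof -
  have "y\<^sup>2 * y \<le> y\<^sup>2 * (1 / 16)" using assms by (intro mult_left_mono) auto
  moreover have "0 \<le> y\<^sup>2 * y" using assms by simp
  moreover have "y * (1 + 6 * y)\<^sup>2 = y + 12 * y\<^sup>2 + 36 * (y\<^sup>2 * y)"
    by (simp add: power2_eq_square algebra_simps)
  ultimately show ?thesis by linarith
qed

text \<open>
The residual norm \<open>e\<close> of the computed inverse is bounded in terms of itself; solving for it
gives \<open>e \<le> y + O(y\<^sup>2)\<close>, hence the leading term \<open>2 * y * b\<close>.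
\<close>

lemma approximate_inverse_scalar_bound:
  fixes b y e b' :: real
  assumes y: "0 \<le> y" "y \<le> 1 / 16" and b: "0 \<le> b" and b': "b' \<le> b * (1 + 6 * y)"
    and e0: "0 \<le> e" and e: "e \<le> (y + 15 * y\<^sup>2) * (1 + e)"
  shows "b' * (2 * e + e\<^sup>2) \<le> 2 * y * b + 85 * b * y\<^sup>2"
proof -
  have y2: "y\<^sup>2 \<le> y / 16" using y mult_left_mono[of y "1 / 16" y] by (simp add: power2_eq_square)
  define q where "q = y + 15 * y\<^sup>2"
  have q0: "0 \<le> q" and q2: "q \<le> 2 * y" using y y2 by (auto simp: q_def)
  have "e \<le> q + q * e" using e by (simp add: q_def algebra_simps)
  moreover have "q * e \<le> (1 / 8) * e" using q2 y e0 by (intro mult_right_mono) auto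
  ultimately have e1: "e \<le> 8 / 7 * q" by linarith
  have "e \<le> q + q * (8 / 7 * q)"
    using \<open>e \<le> q + q * e\<close> mult_left_mono[OF e1 q0] by linarith
  also have "q * (8 / 7 * q) \<le> (2 * y) * (8 / 7 * (2 * y))"
    using q0 q2 y by (intro mult_mono) auto
  also have "(2 * y) * (8 / 7 * (2 * y)) = 32 / 7 * y\<^sup>2" by (simp add: power2_eq_square)
  finally have e2: "e \<le> y + 20 * y\<^sup>2" using zero_le_power2[of y] unfolding q_def by linarith
  then have "e \<le> 9 / 4 * y" using y2 by linarith
  then have "e\<^sup>2 \<le> (9 / 4 * y)\<^sup>2" using e0 by (rule power_mono)
  also have "(9 / 4 * y)\<^sup>2 = 81 / 16 * y\<^sup>2" by (simp add: power2_eq_square)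
  finally have "2 * e + e\<^sup>2 \<le> 2 * y + 46 * y\<^sup>2"
    using e2 zero_le_power2[of y] by linarith
  then have "b' * (2 * e + e\<^sup>2) \<le> b * (1 + 6 * y) * (2 * y + 46 * y\<^sup>2)"
    using b b' y e0 by (intro mult_mono) auto
  also have "\<dots> = b * (2 * y + 58 * y\<^sup>2 + 276 * y * y\<^sup>2)" by (simp add: power2_eq_square algebra_simps)
  also have "\<dots> \<le> b * (2 * y + 85 * y\<^sup>2)"
  proof (rule mult_left_mono[OF _ b])
    have "276 * y * y\<^sup>2 \<le> 276 * (1 / 16) * y\<^sup>2" using y by (intro mult_right_mono mult_left_mono) auto
    then show "2 * y + 58 * y\<^sup>2 + 276 * y * y\<^sup>2 \<le> 2 * y + 85 * y\<^sup>2"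
      using zero_le_power2[of y] by linarith
  qed
  finally show ?thesis by (simp add: algebra_simps)
qed

text \<open>
The exact-arithmetic core: the three residual bounds imply the four estimates with remainders
of order \<open>y\<^sup>2\<close>. All intermediate quantities are first bounded through
the enlarged norms \<open>A' = a * (1 + 6 * y)\<close> and \<open>B' = b * (1 + 6 * y)\<close>, whose product is at least \<open>1\<close>; square
roots of \<open>A' * B'\<close> can therefore be replaced by \<open>A' * B'\<close> itself.
\<close>

lemma W1_perturbation_bounds:
  fixes A11 A12 A22 L K N :: "real^'n^'n" and g :: real
  defines "A \<equiv> block_mat A11 A12 (transpose A12) A22"
    and "P \<equiv> L ** transpose L" and "Q \<equiv> L ** transpose K"
  defines "S \<equiv> schur_complement A11 A12 A22" and "S' \<equiv> schur_complement P Q A22"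
    and "a \<equiv> spectral_norm A11" and "b \<equiv> spectral_norm (matrix_inv A11)" and "\<alpha> \<equiv> spectral_norm A"
    and "x \<equiv> real CARD('n) * g"
  defines "y \<equiv> x * (a * b)"
  assumes sym: "transpose A11 = A11" and pd: "pos_def A"
    and pd': "pos_def (block_mat P Q (transpose Q) A22)"
    and g0: "0 \<le> g" and y16: "y \<le> 1 / 16"
    and r11: "norm (A11 - P) \<le> g * norm L * norm L"
    and r12: "norm (A12 - Q) \<le> g * norm L * norm K"
    and r22: "norm (mat 1 - L ** transpose N) \<le> g * norm L * norm N"
  shows "spectral_norm (matrix_inv P - matrix_inv A11) \<le> y * b + 15 * b * y\<^sup>2"
    and "spectral_norm (S' - S) \<le> 3 * y * \<alpha> + 45 * \<alpha> * y\<^sup>2"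
    and "spectral_norm (matrix_inv P - S') \<le> spectral_norm (matrix_inv A11 - S)
           + y * (b + 3 * \<alpha>) + (15 * b + 45 * \<alpha>) * y\<^sup>2"
    and "spectral_norm (A - block_mat L 0 K N ** transpose (block_mat L 0 K N))
           \<le> spectral_norm (matrix_inv A11 - S) + 2 * x * \<alpha> + 3 * y * (\<alpha> + b)
             + (57 * \<alpha> + 100 * b) * y\<^sup>2"
proof -
  let ?n = "real CARD('n)"
  define c where "c = spectral_norm A22"
  define a' where "a' = spectral_norm P"
  define b' where "b' = spectral_norm (matrix_inv P)"
  define e where "e = spectral_norm (mat 1 - L ** transpose N)"
  note nn = spectral_norm_nonneg
  have n1: "1 \<le> ?n" by (simp add: Suc_leI)
  have pos: "0 \<le> a" "0 \<le> b" "0 \<le> \<alpha>" "0 \<le> c" "0 \<le> a'" "0 \<le> b'" "0 \<le> e" "0 \<le> x"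
    using nn g0 by (simp_all add: a_def b_def \<alpha>_def c_def a'_def b'_def e_def x_def)
  have iA: "invertible A11"
    by (rule pos_def_invertible[OF pos_def_leading_block[OF pd[unfolded A_def]]])
  have iP: "invertible P" by (rule pos_def_invertible[OF pos_def_leading_block[OF pd']])
  have iL: "invertible L"
    by (rule pos_def_factor_invertible) (rule pos_def_leading_block[OF pd', unfolded P_def])
  have symP: "transpose P = P" by (simp add: P_def matrix_transpose_mul)
  have ab: "1 \<le> a * b" unfolding a_def b_def by (rule spectral_norm_inverse_ge[OF iA])
  have ac: "a \<le> \<alpha>" "c \<le> \<alpha>" unfolding a_def c_def \<alpha>_def A_def by (rule spectral_norm_block_diag_le)+
  have y0: "0 \<le> y" using pos by (simp add: y_def)
  have xy: "x \<le> y" using pos ab mult_left_mono[of 1 "a * b" x] by (simp add: y_def)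
  have nL: "norm L \<le> sqrt (?n * a')"
    unfolding a'_def P_def by (rule norm_gram_factor_le)
  have nK: "norm K \<le> sqrt (?n * c)"
    unfolding c_def by (rule norm_offdiagonal_factor_le) (rule pd'[unfolded P_def Q_def])
  have d11: "spectral_norm (A11 - P) \<le> x * a'"
  proof -
    have "g * norm L * norm L \<le> g * sqrt (?n * a') * sqrt (?n * a')"
      using nL g0 pos by (intro mult_mono) auto
    also have "\<dots> = x * a'" using pos by (simp add: x_def)
    finally show ?thesis using r11 spectral_norm_le_norm[of "A11 - P"] by linarith
  qed
  have d12: "spectral_norm (A12 - Q) \<le> x * sqrt (a' * c)"
  proof -
    have "g * norm L * norm K \<le> g * sqrt (?n * a') * sqrt (?n * c)"
      using nL nK g0 pos by (intro mult_mono) auto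
    also have "\<dots> = x * sqrt (a' * c)" using pos by (simp add: x_def real_sqrt_mult)
    finally show ?thesis using r12 spectral_norm_le_norm[of "A12 - Q"] by linarith
  qed
  have inv: "spectral_norm (matrix_inv P - matrix_inv A11) \<le> b * (x * a') * b'"
  proof (rule order_trans[OF inverse_perturbation[OF iA iP]])
    show "spectral_norm (matrix_inv A11) * spectral_norm (A11 - P) * spectral_norm (matrix_inv P)
        \<le> b * (x * a') * b'"
      unfolding b_def b'_def by (intro mult_right_mono mult_left_mono d11 nn)
  qed
  have "a' \<le> a + x * a'"
    using spectral_norm_diff_le[of A11 "A11 - P"] d11 by (simp add: a_def a'_def)
  moreover have "b' \<le> b + b * (x * a') * b'"
    using spectral_norm_add_le[of "matrix_inv A11" "matrix_inv P - matrix_inv A11"] inv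
    by (simp add: b_def b'_def)
  ultimately have a'_le: "a' \<le> a * (1 + 6 * y)" and b'_le: "b' \<le> b * (1 + 6 * y)"
    using perturbed_norm_scalar_bounds[of a b x a' b'] pos ab y16 by (auto simp: y_def)
  have so: "y * (1 + 6 * y)\<^sup>2 \<le> y + 15 * y\<^sup>2" by (rule second_order_factor[OF y0 y16])
  define A' where "A' = a * (1 + 6 * y)"
  define B' where "B' = b * (1 + 6 * y)"
  have AB0: "0 \<le> A'" "0 \<le> B'" using pos y0 by (auto simp: A'_def B'_def)
  have AB: "A' * B' = (a * b) * (1 + 6 * y)\<^sup>2"
    by (simp add: A'_def B'_def power2_eq_square)
  have "1 * 1 \<le> (a * b) * (1 + 6 * y)\<^sup>2"
    using ab y0 by (intro mult_mono) (auto intro!: one_le_power)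
  then have AB1: "1 \<le> A' * B'" by (simp add: AB)
  have xAB: "x * (A' * B') \<le> y + 15 * y\<^sup>2"
    using so by (simp add: AB y_def mult_ac)
  have a'A: "a' \<le> A'" and b'B: "b' \<le> B'" using a'_le b'_le by (simp_all add: A'_def B'_def)

  show 1: "spectral_norm (matrix_inv P - matrix_inv A11) \<le> y * b + 15 * b * y\<^sup>2"
  proof -
    have "b * (x * a') * b' \<le> b * (x * A') * B'"
      using a'A b'B pos AB0 by (intro mult_mono) auto
    also have "\<dots> = b * (x * (A' * B'))" by simp
    also have "\<dots> \<le> b * (y + 15 * y\<^sup>2)" using xAB pos by (intro mult_left_mono) auto
    finally show ?thesis using inv by (simp add: algebra_simps)
  qed

  have d12': "spectral_norm (A12 - Q) \<le> x * sqrt (A' * c)"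
    by (rule order_trans[OF d12]) (use a'A pos in \<open>auto intro!: mult_left_mono mult_right_mono\<close>)
  have d11': "spectral_norm (A11 - P) \<le> x * A'"
    by (rule order_trans[OF d11]) (use a'A pos in \<open>auto intro!: mult_left_mono\<close>)
  have bB: "b \<le> B'" using pos y0 mult_left_mono[of 1 "1 + 6 * y" b] by (simp add: B'_def)
  have Y: "spectral_norm (matrix_inv A11 ** A12) \<le> sqrt (B' * c)"
    by (rule order_trans[OF spectral_norm_inv_times_block[OF pd[unfolded A_def] sym]])
       (use bB pos in \<open>auto simp: b_def c_def intro!: mult_right_mono\<close>)
  have Y': "spectral_norm (matrix_inv P ** Q) \<le> sqrt (B' * c)"
    by (rule order_trans[OF spectral_norm_inv_times_block[OF pd' symP]])
       (use b'B pos in \<open>auto simp: b'_def c_def intro!: mult_right_mono\<close>)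
  show 2: "spectral_norm (S' - S) \<le> 3 * y * \<alpha> + 45 * \<alpha> * y\<^sup>2"
  proof -
    have "spectral_norm (S' - S) \<le> 2 * (x * sqrt (A' * c)) * sqrt (B' * c) + x * A' * (sqrt (B' * c))\<^sup>2"
      unfolding S_def S'_def by (rule schur_complement_perturbation[OF iA sym iP Y Y' d11' d12'])
    also have "\<dots> = 2 * x * (sqrt (A' * c) * sqrt (B' * c)) + x * A' * (sqrt (B' * c))\<^sup>2"
      by (simp only: mult_ac)
    also have "sqrt (A' * c) * sqrt (B' * c) = (sqrt c * sqrt c) * sqrt (A' * B')"
      by (simp only: real_sqrt_mult mult_ac)
    also have "sqrt c * sqrt c = c" using pos by simp
    also have "(sqrt (B' * c))\<^sup>2 = B' * c" using pos AB0 by simp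
    also have "2 * x * (c * sqrt (A' * B')) + x * A' * (B' * c)
        = 2 * x * c * sqrt (A' * B') + x * c * (A' * B')"
      by (simp only: mult_ac)
    also have "\<dots> \<le> 2 * x * c * (A' * B') + x * c * (A' * B')"
      using pos AB0 by (intro add_mono mult_left_mono sqrt_le_self AB1) auto
    also have "\<dots> = 3 * c * (x * (A' * B'))" by simp
    also have "\<dots> \<le> 3 * \<alpha> * (y + 15 * y\<^sup>2)"
      using xAB ac pos AB0 by (intro mult_mono) auto
    finally show ?thesis by (simp add: algebra_simps)
  qed

  show 3: "spectral_norm (matrix_inv P - S') \<le> spectral_norm (matrix_inv A11 - S)
           + y * (b + 3 * \<alpha>) + (15 * b + 45 * \<alpha>) * y\<^sup>2"
  proof -
    have "matrix_inv P - S' = (matrix_inv P - matrix_inv A11) + (matrix_inv A11 - S) - (S' - S)"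
      by simp
    then have "spectral_norm (matrix_inv P - S') \<le> spectral_norm (matrix_inv P - matrix_inv A11)
        + spectral_norm (matrix_inv A11 - S) + spectral_norm (S' - S)"
      using spectral_norm_diff_le[of "(matrix_inv P - matrix_inv A11) + (matrix_inv A11 - S)" "S' - S"]
        spectral_norm_add_le[of "matrix_inv P - matrix_inv A11" "matrix_inv A11 - S"] by simp
    then show ?thesis using 1 2 by (simp add: algebra_simps)
  qed

  have gram: "spectral_norm (N ** transpose N - matrix_inv P) \<le> 2 * y * b + 85 * b * y\<^sup>2"
  proof -
    have N: "spectral_norm (N ** transpose N - matrix_inv P) \<le> b' * (2 * e + e\<^sup>2)"
      "norm N \<le> sqrt (?n * b') * (1 + e)"
      using approximate_inverse_gram[OF iL, of "transpose N"]
      by (simp_all add: b'_def e_def P_def norm_transpose)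
    have "g * norm L * norm N \<le> g * sqrt (?n * a') * (sqrt (?n * b') * (1 + e))"
      using nL N(2) g0 pos by (intro mult_mono) auto
    also have "\<dots> = x * sqrt (a' * b') * (1 + e)" using pos by (simp add: x_def real_sqrt_mult)
    also have "\<dots> \<le> x * (A' * B') * (1 + e)"
    proof (intro mult_right_mono mult_left_mono)
      have "sqrt (a' * b') \<le> sqrt (A' * B')" using a'A b'B pos AB0 by (auto intro!: mult_mono)
      then show "sqrt (a' * b') \<le> A' * B'" using sqrt_le_self[OF AB1] by linarith
    qed (use pos in auto)
    also have "\<dots> \<le> (y + 15 * y\<^sup>2) * (1 + e)" using xAB pos by (intro mult_right_mono) auto
    finally have "e \<le> (y + 15 * y\<^sup>2) * (1 + e)"
      using r22 spectral_norm_le_norm[of "mat 1 - L ** transpose N"] unfolding e_def by linarith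
    from approximate_inverse_scalar_bound[OF y0 y16 pos(2) b'_le pos(7) this] N(1)
    show ?thesis by linarith
  qed

  show "spectral_norm (A - block_mat L 0 K N ** transpose (block_mat L 0 K N))
           \<le> spectral_norm (matrix_inv A11 - S) + 2 * x * \<alpha> + 3 * y * (\<alpha> + b)
             + (57 * \<alpha> + 100 * b) * y\<^sup>2"
  proof -
    have "transpose Q = K ** transpose L" by (simp add: Q_def matrix_transpose_mul)
    moreover have "S' = A22 - K ** transpose K"
      unfolding S'_def P_def Q_def by (rule schur_complement_gram[OF iL])
    moreover have "transpose (0 :: real^'n^'n) = 0" by (simp add: transpose_def vec_eq_iff)
    ultimately have "A - block_mat L 0 K N ** transpose (block_mat L 0 K N)
        = block_mat (A11 - P) (A12 - Q) (transpose (A12 - Q)) (S' - N ** transpose N)"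
      by (simp add: A_def transpose_block_mat block_mat_mult block_mat_diff transpose_diff
          P_def[symmetric] Q_def[symmetric] diff_diff_eq)
    then have "spectral_norm (A - block_mat L 0 K N ** transpose (block_mat L 0 K N))
        \<le> spectral_norm (A11 - P) + spectral_norm (A12 - Q) + spectral_norm (S' - N ** transpose N)"
      using spectral_norm_block_mat_le[of "A11 - P" "A12 - Q" "S' - N ** transpose N"] by simp
    moreover have "spectral_norm (A11 - P) \<le> x * \<alpha> + 6 * \<alpha> * y\<^sup>2"
      and "spectral_norm (A12 - Q) \<le> x * \<alpha> + 6 * \<alpha> * y\<^sup>2"
    proof -
      have A\<alpha>: "A' \<le> \<alpha> * (1 + 6 * y)" using ac pos y0 unfolding A'_def by (intro mult_right_mono) auto
      have "x * (6 * y) \<le> y * (6 * y)" using xy y0 by (intro mult_right_mono) auto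
      then have "\<alpha> * (x * (6 * y)) \<le> \<alpha> * (6 * y\<^sup>2)"
        using pos by (intro mult_left_mono) (auto simp: power2_eq_square)
      then have bound: "x * (\<alpha> * (1 + 6 * y)) \<le> x * \<alpha> + 6 * \<alpha> * y\<^sup>2" by (simp add: algebra_simps)
      have "x * A' \<le> x * (\<alpha> * (1 + 6 * y))" using A\<alpha> pos by (intro mult_left_mono) auto
      then show "spectral_norm (A11 - P) \<le> x * \<alpha> + 6 * \<alpha> * y\<^sup>2" using d11' bound by linarith
      have "c \<le> \<alpha> * (1 + 6 * y)" using ac(2) pos y0 mult_left_mono[of 1 "1 + 6 * y" \<alpha>] by simp
      then have "A' * c \<le> (\<alpha> * (1 + 6 * y))\<^sup>2"
        unfolding power2_eq_square using A\<alpha> AB0 pos y0 by (intro mult_mono) auto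
      then have "sqrt (A' * c) \<le> \<alpha> * (1 + 6 * y)"
        using pos y0 by (intro real_le_lsqrt) auto
      then have "x * sqrt (A' * c) \<le> x * (\<alpha> * (1 + 6 * y))" using pos by (intro mult_left_mono) auto
      then show "spectral_norm (A12 - Q) \<le> x * \<alpha> + 6 * \<alpha> * y\<^sup>2" using d12' bound by linarith
    qed
    moreover have "spectral_norm (S' - N ** transpose N)
        \<le> spectral_norm (matrix_inv P - S') + spectral_norm (N ** transpose N - matrix_inv P)"
      using spectral_norm_add_le[of "matrix_inv P - S'" "N ** transpose N - matrix_inv P"]
      by (simp add: spectral_norm_minus_commute[of S'])
    ultimately show ?thesis using 3 gram by (simp add: algebra_simps)
  qed
qed

section \<open>Asymptotics in the unit roundoff\<close>

lemma gamma_err_le: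
  assumes "0 \<le> u" "real k * u \<le> 1 / 2"
  shows "gamma_err k u \<le> 2 * real k * u"
proof -
  have "real k * u \<le> 2 * (real k * u) * (1 - real k * u)"
    using mult_left_mono[of "1 / 2" "1 - real k * u" "2 * (real k * u)"] assms by simp
  then show ?thesis using assms by (simp add: gamma_err_def pos_divide_le_eq mult.assoc)
qed

lemma gamma_err_nonneg: "0 \<le> u \<Longrightarrow> real k * u < 1 \<Longrightarrow> 0 \<le> gamma_err k u"
  by (simp add: gamma_err_def)

lemma eventually_small_mult:
  fixes d e :: real
  assumes "0 < d"
  shows "\<forall>\<^sub>F u in at_right 0. 0 < u \<and> e * u < d"
proof -
  have "((\<lambda>u. e * u) \<longlongrightarrow> e * 0) (at_right 0)" by (intro tendsto_intros)
  then have "\<forall>\<^sub>F u in at_right 0. e * u < d" using assms by (simp add: order_tendsto_iff)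
  then show ?thesis using eventually_at_right_less[of "0::real"] by eventually_elim simp
qed

lemma gamma_err_bigo: "gamma_err k \<in> O[at_right 0](\<lambda>u. u)"
proof (rule bigoI[where c = "2 * real k"])
  show "\<forall>\<^sub>F u in at_right 0. norm (gamma_err k u) \<le> 2 * real k * norm u"
    using eventually_small_mult[of "1 / 2" "real k"]
    by (auto elim!: eventually_mono simp: gamma_err_nonneg gamma_err_le)
qed

text \<open>
The shape of the remainders: a constant times \<open>y\<^sup>2\<close>, where \<open>y = m * gamma_err k u * d\<close>.
\<close>

lemma gamma_err_squared_bigo:
  "(\<lambda>u. C * (m * gamma_err k u * d)\<^sup>2) \<in> O[at_right 0](\<lambda>u. u\<^sup>2)"
proof -
  have "(\<lambda>u. (gamma_err k u)\<^sup>2) \<in> O[at_right 0](\<lambda>u. u\<^sup>2)"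
    by (rule landau_o.big_power[OF gamma_err_bigo])
  then have "(\<lambda>u. C * m\<^sup>2 * d\<^sup>2 * (gamma_err k u)\<^sup>2) \<in> O[at_right 0](\<lambda>u. u\<^sup>2)"
    by (cases "C * m\<^sup>2 * d\<^sup>2 = 0") simp_all
  then show ?thesis by (simp add: power_mult_distrib mult_ac)
qed

section \<open>Algorithm \<open>W\<^sub>1\<close> in floating-point arithmetic\<close>

lemma fl_W1_residuals:
  fixes A11 A12 L K N :: "real^('n::{finite,linorder})^('n::{finite,linorder})"
  assumes u: "0 \<le> u" "real (CARD('n) + 1) * u < 1"
    and sym: "transpose A11 = A11" and W: "fl_W1 u A11 A12 L K N"
  defines "g \<equiv> gamma_err (CARD('n) + 1) u"
  shows "norm (A11 - L ** transpose L) \<le> g * norm L * norm L"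
    and "norm (A12 - L ** transpose K) \<le> g * norm L * norm K"
    and "norm (mat 1 - L ** transpose N) \<le> g * norm L * norm N"
proof -
  have "u * 1 \<le> u * real (CARD('n) + 1)" using u(1) by (intro mult_left_mono) auto
  then have u1: "u < 1" using u(2) by (simp add: mult.commute)
  have g: "0 \<le> g" unfolding g_def using u by (rule gamma_err_nonneg)
  have chol: "fl_cholesky u A11 L" and K: "fl_forward_subst u L A12 (transpose K)"
    and N: "fl_forward_subst u L (mat 1) (transpose N)"
    using W by (auto simp: fl_W1_def)
  have low: "\<And>i j. i < j \<Longrightarrow> L $ i $ j = 0" using chol unfolding fl_cholesky_def by blast
  show "norm (A11 - L ** transpose L) \<le> g * norm L * norm L"
    by (rule norm_le_componentwise_product[OF _ g])
       (unfold g_def, rule fl_cholesky_residual[OF u(1) u1 u(2) sym chol])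
  show "norm (A12 - L ** transpose K) \<le> g * norm L * norm K"
    by (rule norm_le_componentwise_product[OF _ g])
       (use fl_forward_subst_residual[OF u(1) u1 u(2) low K] in \<open>simp add: g_def transpose_def\<close>)
  show "norm (mat 1 - L ** transpose N) \<le> g * norm L * norm N"
    by (rule norm_le_componentwise_product[OF _ g])
       (use fl_forward_subst_residual[OF u(1) u1 u(2) low N] in \<open>simp add: g_def transpose_def\<close>)
qed

theorem theorem3p12:
  fixes A :: "real^('n::{finite,linorder} + 'n)^('n + 'n)"
    and A11 A12 A22 :: "real^('n::{finite,linorder})^('n::{finite,linorder})"
  assumes "A = block_mat A11 A12 (transpose A12) A22"
    and "transpose A = A"
    and "pos_def A"
  shows "\<exists>r1 r2 r3 r4 :: real \<Rightarrow> real.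
    r1 \<in> O[at_right 0](\<lambda>u. u\<^sup>2) \<and> r2 \<in> O[at_right 0](\<lambda>u. u\<^sup>2) \<and>
    r3 \<in> O[at_right 0](\<lambda>u. u\<^sup>2) \<and> r4 \<in> O[at_right 0](\<lambda>u. u\<^sup>2) \<and>
    (\<forall>\<^sub>F u in at_right 0. \<forall>L11 L21 L22 :: real^('n::{finite,linorder})^('n::{finite,linorder}).
      let n = CARD('n);
          L1 = block_mat L11 0 L21 L22;
          At11 = L11 ** transpose L11;
          At12 = L11 ** transpose L21;
          At = block_mat At11 At12 (transpose At12) A22;
          S = schur_complement A11 A12 A22;
          St = schur_complement At11 At12 A22
      in fl_W1 u A11 A12 L11 L21 L22 \<and> pos_def At \<longrightarrow>
        spectral_norm (matrix_inv At11 - matrix_inv A11)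
          \<le> real n * gamma_err (n + 1) u * cond_number A11 * spectral_norm (matrix_inv A11) + r1 u \<and>
        spectral_norm (St - S)
          \<le> 3 * real n * gamma_err (n + 1) u * cond_number A11 * spectral_norm A + r2 u \<and>
        spectral_norm (matrix_inv At11 - St)
          \<le> spectral_norm (matrix_inv A11 - S)
            + real n * gamma_err (n + 1) u * cond_number A11
                * (spectral_norm (matrix_inv A11) + 3 * spectral_norm A) + r3 u \<and>
        spectral_norm (A - L1 ** transpose L1)
          \<le> spectral_norm (matrix_inv A11 - S)
            + 2 * real n * gamma_err (n + 1) u * spectral_norm A
            + 3 * real n * gamma_err (n + 1) u * cond_number A11
                * (spectral_norm A + spectral_norm (matrix_inv A11)) + r4 u)"
proof -
  define a where "a = spectral_norm A11"
  define b where "b = spectral_norm (matrix_inv A11)"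
  define \<alpha> where "\<alpha> = spectral_norm A"
  define y where "y = (\<lambda>u. real CARD('n) * gamma_err (CARD('n) + 1) u * (a * b))"
  have sym: "transpose A11 = A11"
    using block_mat_eqD[of "transpose A11"] assms(1,2) by (metis transpose_block_mat)
  have ev: "\<forall>\<^sub>F u in at_right 0. 0 < u \<and> real (CARD('n) + 1) * u < 1 \<and> y u \<le> 1 / 16"
    using eventually_small_mult[of "1 / 2" "real (CARD('n) + 1)", OF half_gt_zero[OF zero_less_one]]
      eventually_small_mult[of "1 / 16" "real CARD('n) * (2 * real (CARD('n) + 1)) * (a * b)",
        OF divide_pos_pos[OF zero_less_one zero_less_numeral]]
  proof eventually_elim
    case (elim u)
    have "gamma_err (CARD('n) + 1) u \<le> 2 * real (CARD('n) + 1) * u"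
      using elim by (intro gamma_err_le) auto
    then have "y u \<le> real CARD('n) * (2 * real (CARD('n) + 1) * u) * (a * b)"
      unfolding y_def a_def b_def
      by (intro mult_right_mono mult_left_mono) (auto simp: spectral_norm_nonneg)
    also have "\<dots> = real CARD('n) * (2 * real (CARD('n) + 1)) * (a * b) * u"
      by (simp only: mult_ac)
    finally show ?case using elim by linarith
  qed
  have O: "(\<lambda>u. C * (y u)\<^sup>2) \<in> O[at_right 0](\<lambda>u. u\<^sup>2)" for C
    unfolding y_def by (rule gamma_err_squared_bigo)
  have bounds: "\<forall>\<^sub>F u in at_right 0. \<forall>L11 L21 L22 :: real^('n::{finite,linorder})^('n::{finite,linorder}).
      fl_W1 u A11 A12 L11 L21 L22 \<and>
      pos_def (block_mat (L11 ** transpose L11) (L11 ** transpose L21)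
        (transpose (L11 ** transpose L21)) A22) \<longrightarrow>
      spectral_norm (matrix_inv (L11 ** transpose L11) - matrix_inv A11)
        \<le> y u * b + 15 * b * (y u)\<^sup>2 \<and>
      spectral_norm (schur_complement (L11 ** transpose L11) (L11 ** transpose L21) A22
          - schur_complement A11 A12 A22)
        \<le> 3 * y u * \<alpha> + 45 * \<alpha> * (y u)\<^sup>2 \<and>
      spectral_norm (matrix_inv (L11 ** transpose L11)
          - schur_complement (L11 ** transpose L11) (L11 ** transpose L21) A22)
        \<le> spectral_norm (matrix_inv A11 - schur_complement A11 A12 A22)
          + y u * (b + 3 * \<alpha>) + (15 * b + 45 * \<alpha>) * (y u)\<^sup>2 \<and>
      spectral_norm (A - block_mat L11 0 L21 L22 ** transpose (block_mat L11 0 L21 L22))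
        \<le> spectral_norm (matrix_inv A11 - schur_complement A11 A12 A22)
          + 2 * (real CARD('n) * gamma_err (CARD('n) + 1) u) * \<alpha> + 3 * y u * (\<alpha> + b)
          + (57 * \<alpha> + 100 * b) * (y u)\<^sup>2"
    using ev
  proof eventually_elim
    case (elim u)
    have u: "0 \<le> u" "real (CARD('n) + 1) * u < 1" using elim by auto
    have y16: "real CARD('n) * gamma_err (CARD('n) + 1) u *
        (spectral_norm A11 * spectral_norm (matrix_inv A11)) \<le> 1 / 16"
      using elim by (simp only: y_def a_def b_def)
    show ?case
    proof (intro allI impI, elim conjE, goal_cases)
      case (1 L K N)
      note estimates = W1_perturbation_bounds[OF sym assms(3)[unfolded assms(1)] 1(2)
          gamma_err_nonneg[OF u] y16 fl_W1_residuals[OF u sym 1(1)], folded assms(1)]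
      show ?case unfolding y_def a_def b_def \<alpha>_def by (intro conjI estimates)
    qed
  qed
  show ?thesis
    by (rule exI[of _ "\<lambda>u. 15 * b * (y u)\<^sup>2"],
        rule exI[of _ "\<lambda>u. 45 * \<alpha> * (y u)\<^sup>2"],
        rule exI[of _ "\<lambda>u. (15 * b + 45 * \<alpha>) * (y u)\<^sup>2"],
        rule exI[of _ "\<lambda>u. (57 * \<alpha> + 100 * b) * (y u)\<^sup>2"],
        intro conjI O)
       (use bounds in \<open>simp only: Let_def y_def a_def b_def \<alpha>_def cond_number_def mult_ac\<close>)
qed

end
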